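(* Let $X$ be a nonzero complex Banach space with open unit ball $\mathbb{B}$, let $0\le\alpha<1$, let $g:\mathbb{B}\to\mathbb{C}$ be holomorphic with $g(0)=1$, and define $F(x)=g(x)x$ for $x\in\mathbb{B}$. Suppose that $F\in\mathcal{S}^*_{\mathbb{B}}(\alpha)$. Then for every $x_0\in X$ with $\|x_0\|=1$ and every $T_{x_0}\in T(x_0)$, the quantity $J_{2,3}(F)=A_2A_3-A_4$ satisfies $$|J_{2,3}(F)|\le\begin{cases}\dfrac{2}{3}(1-\alpha)\big[4(1-\alpha)^2-1\big], & 0\le\alpha\le 1-\dfrac{\sqrt3}{2},\\[3mm] \dfrac{2(1-\alpha)}{3\sqrt{1-(1-\alpha)^2}}, & 1-\dfrac{\sqrt3}{2}<\alpha<1.\end{cases}$$ Moreover, the estimate is sharp: for every nonzero complex Banach space $X$ and every $0\le\alpha<1$ there are a mapping $F\in\mathcal{S}^*_{\mathbb{B}}(\alpha)$ of the form $F(x)=g(x)x$ with $g:\mathbb{B}\to\mathbb{C}$ holomorphic and $g(0)=1$, a unit vector $x_0$ and $T_{x_0}\in T(x_0)$ for which equality holds in this bound on $|J_{2,3}(F)|$.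
   Context: $X$ is a complex Banach space with norm $\|\cdot\|$ and $\mathbb{B}=\{x\in X:\|x\|<1\}$. For $x\in X\setminus\{0\}$, $T(x)$ is the (nonempty) set of bounded linear functionals $T_x:X\to\mathbb{C}$ with $\|T_x\|=1$ and $T_x(x)=\|x\|$. For holomorphic $F:\mathbb{B}\to X$, $DF(x)$ is the Fréchet derivative at $x$, $D^nF(x)$ is the $n$th Fréchet derivative (a bounded symmetric $n$-linear map $X^n\to X$). $F$ is normalized if $F(0)=0$ and $DF(0)=I$ (the identity), and locally biholomorphic if $DF(x)$ is invertible with bounded inverse for every $x\in\mathbb{B}$. Class $\mathcal{S}^*_{\mathbb{B}}(\alpha)$ (starlike mappings of order $\alpha$): for $0<\alpha<1$, the set of normalized locally biholomorphic $F:\mathbb{B}\to X$ such that $$\left|\frac{1}{\|x\|}T_x\big((DF(x))^{-1}F(x)\big)-\frac{1}{2\alpha}\right|<\frac{1}{2\alpha}\quad\text{for all }x\in\mathbb{B}\setminus\{0\},\ T_x\in T(x);$$ equivalently, $\operatorname{Re}\big(\|x\|/T_x((DF(x))^{-1}F(x))\big)>\alpha$ for all such $x,T_x$. For $\alpha=0$, $\mathcal{S}^*_{\mathbb{B}}(0)=\mathcal{S}^*_{\mathbb{B}}$ is the set of normalized locally biholomorphic $F$ with $\operatorname{Re}\,T_x((DF(x))^{-1}F(x))>0$ for all $x\in\mathbb{B}\setminus\{0\}$, $T_x\in T(x)$. Given $x_0$ with $\|x_0\|=1$ and $T_{x_0}\in T(x_0)$, put $A_n=\frac{1}{n!}T_{x_0}\big(D^nF(0)(x_0,\ldots,x_0)\big)$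 ($x_0$ repeated $n$ times) for $n=2,3,4$. *)

theory Defs
  imports "HOL-Analysis.Analysis"
begin

text \<open>Complex Banach spaces. The real scalar multiplication of \<^class>\<open>real_normed_vector\<close> is
  the restriction of the complex one, so that the library's derivatives and bounded linear maps
  apply; complex linearity is demanded separately.\<close>

class complex_normed_vector = real_normed_vector +
  fixes scaleC :: "complex \<Rightarrow> 'a \<Rightarrow> 'a" (infixr "*\<^sub>C" 75)
  assumes scaleC_add_right: "c *\<^sub>C (x + y) = c *\<^sub>C x + c *\<^sub>C y"
    and scaleC_add_left: "(c + d) *\<^sub>C x = c *\<^sub>C x + d *\<^sub>C x"
    and scaleC_scaleC: "c *\<^sub>C (d *\<^sub>C x) = (c * d) *\<^sub>C x"
    and scaleC_one: "1 *\<^sub>C x = x"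
    and scaleC_of_real: "complex_of_real r *\<^sub>C x = r *\<^sub>R x"
    and norm_scaleC: "norm (c *\<^sub>C x) = cmod c * norm x"

class complex_banach = complex_normed_vector + banach

instantiation complex :: complex_banach
begin

definition scaleC_complex :: "complex \<Rightarrow> complex \<Rightarrow> complex" where
  "scaleC_complex c z = c * z"

instance
  by standard
    (auto simp: scaleC_complex_def algebra_simps norm_mult scaleR_conv_of_real)

end

definition complex_linear ::
  "('a::complex_normed_vector \<Rightarrow> 'b::complex_normed_vector) \<Rightarrow> bool" where
  "complex_linear f \<longleftrightarrow>
     (\<forall>x y. f (x + y) = f x + f y) \<and> (\<forall>c x. f (c *\<^sub>C x) = c *\<^sub>C f x)"

definition cholomorphic_on ::
  "('a::complex_normed_vector \<Rightarrow> 'b::complex_normed_vector) \<Rightarrow> 'a set \<Rightarrow> bool"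
  (infixl "cholomorphic'_on" 50) where
  "f cholomorphic_on S \<longleftrightarrow>
     (\<forall>x\<in>S. \<exists>f'. (f has_derivative f') (at x) \<and> complex_linear f')"

text \<open>The Frechet derivative as an element of the normed space of bounded linear maps. Hence
  it can be iterated: \<open>fderiv (fderiv F) x\<close> is the derivative of \<open>fderiv F\<close> with respect to the
  operator norm, and \<open>fderiv (fderiv F) x u v\<close> is the value of the bilinear map
  $D^2F(x)$ at $(u,v)$. For a holomorphic map it is the complex Frechet derivative. On an open
  set the values depend only on the restriction of the map to that set.\<close>

definition fderiv ::
  "('a::real_normed_vector \<Rightarrow> 'b::real_normed_vector) \<Rightarrow> 'a \<Rightarrow> 'a \<Rightarrow>\<^sub>L 'b" where
  "fderiv F x = Blinfun (frechet_derivative F (at x))"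

definition support_functionals ::
  "'a::complex_normed_vector \<Rightarrow> ('a \<Rightarrow>\<^sub>L complex) set" where
  "support_functionals x =
     {T. complex_linear (blinfun_apply T) \<and> norm T = 1 \<and>
         blinfun_apply T x = complex_of_real (norm x)}"

definition normalized_map :: "('a::complex_banach \<Rightarrow> 'a) \<Rightarrow> bool" where
  "normalized_map F \<longleftrightarrow> F 0 = 0 \<and> fderiv F 0 = id_blinfun"

definition locally_biholomorphic :: "('a::complex_banach \<Rightarrow> 'a) \<Rightarrow> bool" where
  "locally_biholomorphic F \<longleftrightarrow> F cholomorphic_on ball 0 1 \<and>
     (\<forall>x\<in>ball 0 1. \<exists>G. fderiv F x o\<^sub>L G = id_blinfun \<and> G o\<^sub>L fderiv F x = id_blinfun)"

text \<open>Maps are total functions here; only their values on the open unit ball matter. The order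
  \<open>\<alpha>\<close> is meant to range over $0 \le \alpha < 1$.\<close>

definition starlike_maps :: "real \<Rightarrow> ('a::complex_banach \<Rightarrow> 'a) set" where
  "starlike_maps \<alpha> = {F. normalized_map F \<and> locally_biholomorphic F \<and>
     (\<forall>x\<in>ball 0 1 - {0}. \<forall>T\<in>support_functionals x.
        let w = blinfun_apply T (inv (blinfun_apply (fderiv F x)) (F x)) in
        if \<alpha> = 0 then Re w > 0
        else cmod (w / complex_of_real (norm x) - complex_of_real (1 / (2 * \<alpha>))) < 1 / (2 * \<alpha>))}"

definition coeff2 :: "('a::complex_banach \<Rightarrow> 'a) \<Rightarrow> 'a \<Rightarrow> ('a \<Rightarrow>\<^sub>L complex) \<Rightarrow> complex" where
  "coeff2 F x0 T = blinfun_apply T (fderiv (fderiv F) 0 x0 x0) / fact 2"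

definition coeff3 :: "('a::complex_banach \<Rightarrow> 'a) \<Rightarrow> 'a \<Rightarrow> ('a \<Rightarrow>\<^sub>L complex) \<Rightarrow> complex" where
  "coeff3 F x0 T = blinfun_apply T (fderiv (fderiv (fderiv F)) 0 x0 x0 x0) / fact 3"

definition coeff4 :: "('a::complex_banach \<Rightarrow> 'a) \<Rightarrow> 'a \<Rightarrow> ('a \<Rightarrow>\<^sub>L complex) \<Rightarrow> complex" where
  "coeff4 F x0 T = blinfun_apply T (fderiv (fderiv (fderiv (fderiv F))) 0 x0 x0 x0 x0) / fact 4"

definition J23 :: "('a::complex_banach \<Rightarrow> 'a) \<Rightarrow> 'a \<Rightarrow> ('a \<Rightarrow>\<^sub>L complex) \<Rightarrow> complex" where
  "J23 F x0 T = coeff2 F x0 T * coeff3 F x0 T - coeff4 F x0 T"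

definition J23_bound :: "real \<Rightarrow> real" where
  "J23_bound \<alpha> =
     (if \<alpha> \<le> 1 - sqrt 3 / 2 then 2 / 3 * (1 - \<alpha>) * (4 * (1 - \<alpha>)\<^sup>2 - 1)
      else 2 * (1 - \<alpha>) / (3 * sqrt (1 - (1 - \<alpha>)\<^sup>2)))"

end

theory Submission
  imports Defs "HOL-Complex_Analysis.Complex_Analysis"
begin

text \<open>On the line through a unit vector $u$, a starlike map $F(x) = g(x) x$ of order $\alpha = 1 - \beta$
  becomes the function $z G(z)$ with $G(z) = g(zu)$, and the quotient $w$ in the definition of starlikeness is
  $\|x\| / q$ with $q = 1 + z G'/G$. Hence $q = 1 + \beta (p - 1)$ where $p(0) = 1$ and
  $\operatorname{Re} p > 0$, and comparing coefficients gives
  $A_2 A_3 - A_4 = \frac{\beta}{3} (\beta^2 p_1^3 - p_3)$.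

  A rotation makes $\beta^2 p_1^3 - p_3$ real and nonnegative while $a = \operatorname{Re} p_1 / 2 \ge 0$. Integrating
  $\operatorname{Re} p$ against the nonnegative polynomial
  $4 (\cos t - A)^2 (\cos t + 2A) = \cos 3t + (3 - 12 A^2) \cos t + 8 A^3$ with $A = \max(a, 1/2)$ bounds
  $- \operatorname{Re} p_3$ by a function of $a$, and the resulting cubic in $a$ is maximised by hand. Equality
  holds for $G(z) = (1 - 2 z \cos\theta + z^2)^{-\beta}$, composed with a support functional.

  That the iterated derivatives of a holomorphic map exist in operator norm is part of the argument: by
  Hahn--Banach, the Cauchy estimates for scalar functions carry over to values in a Banach space.\<close>

section \<open>The Hahn--Banach theorem\<close>

text \<open>The polynomial is the certificate of an extremal problem on measures. By Herglotz,
  \<open>Re p_1 / 2\<close> and \<open>Re p_3 / 2\<close> are the means of \<open>cos t\<close> and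
  \<open>cos 3t\<close> for one probability measure. With \<open>x = cos t\<close>, the largest
  \<open>- Re p_3 / 2\<close> for a given mean \<open>a\<close> is therefore the value at
  \<open>a\<close> of the concave envelope of \<open>3x - 4x^3\<close> on \<open>[-1, 1]\<close>:
  constantly 1 up to \<open>x = 1/2\<close>, where the tangent is horizontal and meets the curve
  again at \<open>x = -1\<close>, and the cubic itself beyond. The polynomial is the tangent at
  \<open>x = A\<close> minus the curve, hence \<open>A = max(a, 1/2)\<close>. For
  \<open>a >= 1/2\<close> this leaves \<open>3a - 4 s^2 a^3\<close> with
  \<open>s^2 = 1 - \<beta>^2\<close>, which peaks at \<open>a = 1/(2s)\<close> with value
  \<open>1/s\<close>. The peak lies in \<open>[0, 1]\<close> exactly when
  \<open>\<beta>^2 <= 3/4\<close>; otherwise the endpoint \<open>a = 1\<close> wins, with value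
  \<open>4 \<beta>^2 - 1\<close>. This is the origin of the two cases and of
  \<open>sqrt 3 / 2\<close>. The maximising \<open>a\<close> is also the cosine of the extremal
  angle \<theta>.\<close>

text \<open>Zorn's lemma is applied to the graphs of the partial functionals, as subspaces of the product with
  the reals; a subspace on which \<open>r \<le> norm x\<close> is automatically single-valued.\<close>

lemma hahn_banach_norm:
  fixes x0 :: "'a::real_normed_vector"
  obtains f :: "'a \<Rightarrow> real" where "linear f" "\<And>x. \<bar>f x\<bar> \<le> norm x" "f x0 = norm x0"
proof -
  define \<A> :: "('a \<times> real) set set" where
    "\<A> = {G. subspace G \<and> (\<forall>(x, r)\<in>G. r \<le> norm x) \<and> (x0, norm x0) \<in> G}"
  have "t * norm x0 \<le> norm (t *\<^sub>R x0)" for t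
    by (simp add: mult_right_mono)
  moreover have "span {(x0, norm x0)} = range (\<lambda>t. (t *\<^sub>R x0, t * norm x0))"
    by (simp add: span_singleton)
  ultimately have "span {(x0, norm x0)} \<in> \<A>"
    unfolding \<A>_def using span_base[of "(x0, norm x0)" "{(x0, norm x0)}"] subspace_span[of "{(x0, norm x0)}"] by auto
  then have ne: "\<A> \<noteq> {}" by blast
  have chain: "\<Union>\<C> \<in> \<A>" if "\<C> \<noteq> {}" and \<C>: "subset.chain \<A> \<C>" for \<C>
  proof -
    have sub: "G \<in> \<A>" if "G \<in> \<C>" for G
      using \<C> that unfolding subset.chain_def by blast
    have two: "\<exists>G\<in>\<C>. a \<in> G \<and> b \<in> G" if "a \<in> \<Union>\<C>" "b \<in> \<Union>\<C>" for a b
      using \<C> that unfolding subset_chain_def by (meson Union_iff subsetD)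
    obtain G0 where "G0 \<in> \<C>" using \<open>\<C> \<noteq> {}\<close> by blast
    then have base: "0 \<in> \<Union>\<C>" "(x0, norm x0) \<in> \<Union>\<C>"
      using sub subspace_0 unfolding \<A>_def by blast+
    have "a + b \<in> \<Union>\<C>" if "a \<in> \<Union>\<C>" "b \<in> \<Union>\<C>" for a b
      using two[OF that] sub subspace_add unfolding \<A>_def by blast
    moreover have "c *\<^sub>R a \<in> \<Union>\<C>" if "a \<in> \<Union>\<C>" for a c
      using that sub subspace_scale unfolding \<A>_def by blast
    moreover have "\<forall>(x, r)\<in>\<Union>\<C>. r \<le> norm x"
      using sub unfolding \<A>_def by blast
    ultimately show ?thesis
      using base unfolding \<A>_def subspace_def by blast
  qed
  obtain G where G: "G \<in> \<A>" and max: "\<And>H. H \<in> \<A> \<Longrightarrow> G \<subseteq> H \<Longrightarrow> H = G"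
    using subset_Zorn_nonempty[OF ne chain] by metis
  have sG: "subspace G" and dom: "\<And>x r. (x, r) \<in> G \<Longrightarrow> r \<le> norm x" and x0G: "(x0, norm x0) \<in> G"
    using G unfolding \<A>_def by auto
  have ex: "\<exists>r. (y, r) \<in> G" for y
  proof -
    have sep: "r - norm (u - y) \<le> norm (v + y) - s" if "(u, r) \<in> G" "(v, s) \<in> G" for u r v s
    proof -
      have "r + s \<le> norm (u + v)"
        using subspace_add[OF sG that] dom by simp
      also have "\<dots> \<le> norm (u - y) + norm (v + y)"
        using norm_triangle_ineq[of "u - y" "v + y"] by simp
      finally show ?thesis by simp
    qed
    \<comment> \<open>The value at \<open>y\<close> must lie above every left side and below every
      right side of \<open>sep\<close>; the supremum of the left sides does. These are the
      constraints for \<open>t = -1\<close> and \<open>t = 1\<close>, and every other nonzero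
      \<open>t\<close> reduces to them by scaling \<open>u\<close>.\<close>
    define a where "a = (SUP (u, r)\<in>G. r - norm (u - y))"
    have bdd: "bdd_above ((\<lambda>(u, r). r - norm (u - y)) ` G)"
      using sep[OF _ x0G] by (intro bdd_aboveI2) auto
    have lo: "r - norm (u - y) \<le> a" if "(u, r) \<in> G" for u r
      unfolding a_def using cSUP_upper[OF that bdd] by simp
    have up: "a \<le> norm (v + y) - s" if "(v, s) \<in> G" for v s
      unfolding a_def using x0G sep[OF _ that] by (intro cSUP_least) auto
    define H where "H = {(u + t *\<^sub>R y, r + t * a) | u r t. (u, r) \<in> G}"
    have "subspace H"
    proof (rule subspaceI)
      show "0 \<in> H"
        using subspace_0[OF sG] unfolding H_def by (force simp: zero_prod_def)
      show "p + q \<in> H" if pq: "p \<in> H" "q \<in> H" for p q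
      proof -
        obtain u r t v s t' where "p = (u + t *\<^sub>R y, r + t * a)" "(u, r) \<in> G"
          "q = (v + t' *\<^sub>R y, s + t' * a)" "(v, s) \<in> G" using pq unfolding H_def by blast
        then have "p + q = ((u + v) + (t + t') *\<^sub>R y, (r + s) + (t + t') * a)" "(u + v, r + s) \<in> G"
          using subspace_add[OF sG, of "(u, r)" "(v, s)"] by (auto simp: algebra_simps)
        then show ?thesis unfolding H_def by blast
      qed
      show "c *\<^sub>R p \<in> H" if p: "p \<in> H" for c p
      proof -
        obtain u r t where "p = (u + t *\<^sub>R y, r + t * a)" "(u, r) \<in> G"
          using p unfolding H_def by blast
        then have "c *\<^sub>R p = (c *\<^sub>R u + (c * t) *\<^sub>R y, c * r + (c * t) * a)" "(c *\<^sub>R u, c * r) \<in> G"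
          using subspace_scale[OF sG, of "(u, r)" c] by (auto simp: algebra_simps)
        then show ?thesis unfolding H_def by blast
      qed
    qed
    moreover have GH: "G \<subseteq> H"
      unfolding H_def by (force intro: exI[of _ 0])
    moreover have "r + t * a \<le> norm (u + t *\<^sub>R y)" if ur: "(u, r) \<in> G" for u r t
    proof (cases t "0::real" rule: linorder_cases)
      case equal
      then show ?thesis using dom[OF ur] by simp
    next
      case greater
      have "((1/t) *\<^sub>R u, (1/t) * r) \<in> G"
        using subspace_scale[OF sG ur, of "1/t"] by simp
      from up[OF this] have "t * a \<le> t * (norm ((1/t) *\<^sub>R u + y) - (1/t) * r)"
        using greater by (simp add: mult_left_mono)
      also have "\<dots> = norm (t *\<^sub>R ((1/t) *\<^sub>R u + y)) - r"
        using greater unfolding norm_scaleR by (simp add: algebra_simps)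
      also have "t *\<^sub>R ((1/t) *\<^sub>R u + y) = u + t *\<^sub>R y"
        using greater by (simp add: algebra_simps)
      finally show ?thesis by simp
    next
      case less
      define k where "k = - t"
      have k: "k > 0" "t = - k" using less by (auto simp: k_def)
      have uk: "((1/k) *\<^sub>R u, (1/k) * r) \<in> G"
        using subspace_scale[OF sG ur, of "1/k"] by simp
      have eq: "k *\<^sub>R ((1/k) *\<^sub>R u - y) = u + t *\<^sub>R y"
        using k by (simp add: algebra_simps)
      from lo[OF uk] have "k * ((1/k) * r - norm ((1/k) *\<^sub>R u - y)) \<le> k * a"
        using k by (intro mult_left_mono) auto
      moreover have "k * ((1/k) * r - norm ((1/k) *\<^sub>R u - y)) = r - norm (u + t *\<^sub>R y)"
        using k unfolding eq[symmetric] norm_scaleR by (simp add: algebra_simps)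
      moreover have "t * a = - (k * a)" using k by simp
      ultimately show ?thesis by linarith
    qed
    then have "\<forall>(x, r)\<in>H. r \<le> norm x"
      unfolding H_def by blast
    ultimately have "H \<in> \<A>"
      using x0G unfolding \<A>_def by blast
    then have "H = G" using max GH by blast
    moreover have "(y, a) \<in> H"
      unfolding H_def using subspace_0[OF sG] by (force simp: zero_prod_def intro: exI[of _ 1])
    ultimately show ?thesis by blast
  qed
  have uniq: "r = s" if "(x, r) \<in> G" "(x, s) \<in> G" for x r s
    using dom[of 0 "r - s"] dom[of 0 "s - r"] subspace_diff[OF sG that] subspace_diff[OF sG that(2,1)]
    by simp
  define f where "f x = (SOME r. (x, r) \<in> G)" for x
  have f: "(x, f x) \<in> G" for x
    unfolding f_def using ex by (rule someI_ex)
  have fle: "f x \<le> norm x" for x using dom[OF f] .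
  have lin: "linear f"
  proof (rule linearI)
    show "f (x + y) = f x + f y" for x y
      using uniq[OF f] subspace_add[OF sG f f] by simp
    show "f (c *\<^sub>R x) = c *\<^sub>R f x" for c x
      using uniq[OF f] subspace_scale[OF sG f] by simp
  qed
  have "\<bar>f x\<bar> \<le> norm x" for x
    using fle[of x] fle[of "- x"] linear_neg[OF lin, of x] by simp
  moreover have "f x0 = norm x0"
    using uniq[OF f x0G] .
  ultimately show ?thesis using that lin by blast
qed

text \<open>A complex linear functional is determined by its real part \<open>f\<close> through
  \<open>f x - i f(i x)\<close>. Rotating \<open>x\<close> until the value is a nonnegative real
  turns the bound on \<open>f\<close> into the bound on the modulus. At \<open>x0\<close> the real
  part already equals \<open>norm x0\<close>, so that bound forces the imaginary part to
  vanish.\<close>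

lemma complex_hahn_banach:
  fixes x0 :: "'a::complex_normed_vector"
  obtains T :: "'a \<Rightarrow>\<^sub>L complex" where "complex_linear T" "\<And>x. cmod (T x) \<le> norm x" "T x0 = norm x0"
proof -
  obtain f :: "'a \<Rightarrow> real" where lin: "linear f" and le: "\<And>x. \<bar>f x\<bar> \<le> norm x" and x0: "f x0 = norm x0"
    using hahn_banach_norm[of x0] by blast
  define t where "t x = Complex (f x) (- f (\<i> *\<^sub>C x))" for x
  have add: "t (x + y) = t x + t y" for x y
    by (simp add: t_def linear_add[OF lin] scaleC_add_right complex_eq_iff)
  have scale: "t (c *\<^sub>C x) = c * t x" for c x
  proof -
    have "c *\<^sub>C x = Re c *\<^sub>R x + Im c *\<^sub>R (\<i> *\<^sub>C x)"
    proof -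
      have "c = complex_of_real (Re c) + complex_of_real (Im c) * \<i>"
        by (simp add: complex_eq_iff)
      then have "c *\<^sub>C x = (complex_of_real (Re c) + complex_of_real (Im c) * \<i>) *\<^sub>C x"
        by (rule arg_cong)
      then show ?thesis
        by (simp only: scaleC_add_left scaleC_of_real flip: scaleC_scaleC)
    qed
    moreover have "\<i> *\<^sub>C c *\<^sub>C x = Re c *\<^sub>R (\<i> *\<^sub>C x) + (- Im c) *\<^sub>R x"
    proof -
      have "\<i> * c = complex_of_real (Re c) * \<i> + complex_of_real (- Im c)"
        by (simp add: complex_eq_iff)
      then have "(\<i> * c) *\<^sub>C x = (complex_of_real (Re c) * \<i> + complex_of_real (- Im c)) *\<^sub>C x"
        by (rule arg_cong)
      then show ?thesis
        unfolding scaleC_scaleC scaleC_add_left scaleC_of_real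
        by (simp only: scaleC_of_real flip: scaleC_scaleC)
    qed
    ultimately show ?thesis
      by (simp add: t_def linear_add[OF lin] linear_diff[OF lin] linear_scale[OF lin] linear_neg[OF lin] complex_eq_iff)
  qed
  have bound: "cmod (t x) \<le> norm x" for x
  proof (cases "t x = 0")
    case False
    define c where "c = cnj (t x) / cmod (t x)"
    have "t x * cnj (t x) = cmod (t x) * complex_of_real (cmod (t x))"
      using complex_norm_square[of "t x"] by (simp add: power2_eq_square)
    then have "t (c *\<^sub>C x) = cmod (t x)"
      using False unfolding scale c_def by (simp add: field_simps)
    then have "cmod (t x) = f (c *\<^sub>C x)"
      by (simp add: t_def complex_eq_iff)
    also have "\<dots> \<le> norm (c *\<^sub>C x)"
      using le[of "c *\<^sub>C x"] by simp
    also have "\<dots> = norm x"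
      using False by (simp add: norm_scaleC c_def norm_divide)
    finally show ?thesis .
  qed simp
  have "t (r *\<^sub>R x) = r *\<^sub>R t x" for r x
    using scale[of "of_real r" x] by (simp add: scaleC_of_real scaleR_conv_of_real)
  then have "bounded_linear t"
    using add bound by (intro bounded_linear_intro[where K=1]) auto
  then have T: "blinfun_apply (Blinfun t) = t"
    by (rule bounded_linear_Blinfun_apply)
  have "t x0 = norm x0"
  proof -
    have "(norm x0)\<^sup>2 + (Im (t x0))\<^sup>2 \<le> (norm x0)\<^sup>2"
      using power_mono[OF bound[of x0], of 2] x0 by (simp add: cmod_power2 t_def)
    then have "Im (t x0) = 0" by simp
    then show ?thesis using x0 by (simp add: t_def complex_eq_iff)
  qed
  then show ?thesis
    using that[of "Blinfun t"] add scale bound unfolding T complex_linear_def scaleC_complex_def by blast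
qed

section \<open>Complex linear maps\<close>

lemma bounded_linear_scaleC_right: "bounded_linear (\<lambda>x::'a::complex_normed_vector. c *\<^sub>C x)"
proof (rule bounded_linear_intro[where K="cmod c"])
  show "c *\<^sub>C r *\<^sub>R x = r *\<^sub>R c *\<^sub>C x" for r and x :: 'a
    by (metis mult.commute scaleC_of_real scaleC_scaleC)
qed (simp_all add: scaleC_add_right norm_scaleC mult.commute)

lemma scaleC_zero_right [simp]: "c *\<^sub>C 0 = (0::'a::complex_normed_vector)"
  and scaleC_zero_left [simp]: "0 *\<^sub>C (x::'a) = 0"
  using norm_scaleC[of c "0::'a"] norm_scaleC[of 0 x] by simp_all

lemma complex_linear_add: "complex_linear f \<Longrightarrow> f (x + y) = f x + f y"
  and complex_linear_scale: "complex_linear f \<Longrightarrow> f (c *\<^sub>C x) = c *\<^sub>C f x"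
  by (simp_all add: complex_linear_def)

text \<open>This makes \<open>fderiv f\<close> again a map between complex normed spaces, so that
  holomorphy can be asserted of it and iterated. Scalars act on the values; the elements remain real
  linear maps, and their complex linearity is tracked separately by
  \<open>complex_linear\<close>.\<close>

instantiation blinfun :: (real_normed_vector, complex_normed_vector) complex_normed_vector
begin

definition scaleC_blinfun :: "complex \<Rightarrow> ('a \<Rightarrow>\<^sub>L 'b) \<Rightarrow> 'a \<Rightarrow>\<^sub>L 'b" where
  "scaleC_blinfun c f = Blinfun (\<lambda>x. c *\<^sub>C f x)"

lemma scaleC_blinfun_apply [simp]:
  "blinfun_apply (c *\<^sub>C f) x = c *\<^sub>C f x" for f :: "'a \<Rightarrow>\<^sub>L 'b"
  unfolding scaleC_blinfun_def
  by (subst bounded_linear_Blinfun_apply)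
    (auto intro: bounded_linear_compose[OF bounded_linear_scaleC_right] blinfun.bounded_linear_right)

instance
proof
  fix c d :: complex and f g :: "'a \<Rightarrow>\<^sub>L 'b" and r :: real
  have le: "norm (c *\<^sub>C f) \<le> cmod c * norm f" for c and f :: "'a \<Rightarrow>\<^sub>L 'b"
  proof (rule norm_blinfun_bound)
    show "norm ((c *\<^sub>C f) x) \<le> cmod c * norm f * norm x" for x
      using norm_blinfun[of f x] by (simp add: norm_scaleC mult.assoc mult_left_mono)
  qed simp
  show "norm (c *\<^sub>C f) = cmod c * norm f"
  proof (cases "c = 0")
    case False
    have "f = inverse c *\<^sub>C c *\<^sub>C f"
      using False by (intro blinfun_eqI) (simp add: scaleC_scaleC scaleC_one)
    then have "norm f \<le> inverse (cmod c) * norm (c *\<^sub>C f)"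
      by (metis le norm_inverse)
    then have "cmod c * norm f \<le> norm (c *\<^sub>C f)"
      using False by (simp add: field_simps)
    then show ?thesis using le[of c f] by simp
  qed (use le[of 0 f] in simp)
qed (auto intro!: blinfun_eqI
      simp: scaleC_add_right scaleC_add_left scaleC_scaleC scaleC_one scaleC_of_real blinfun.bilinear_simps)

end

instance blinfun :: (real_normed_vector, complex_banach) complex_banach ..

lemma fderiv_eq: "(f has_derivative f') (at x) \<Longrightarrow> blinfun_apply (fderiv f x) = f'"
  unfolding fderiv_def
  by (metis bounded_linear_Blinfun_apply frechet_derivative_at has_derivative_bounded_linear)

lemma cholomorphic_onD:
  assumes "f cholomorphic_on S" "x \<in> S"
  shows has_derivative_fderiv: "(f has_derivative fderiv f x) (at x)"
    and complex_linear_fderiv: "complex_linear (fderiv f x)"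
  using assms fderiv_eq unfolding cholomorphic_on_def by metis+

text \<open>Bounds on the Taylor remainder are needed only for scalar functions: a functional that
  attains the norm transfers them to values in a Banach space.\<close>

lemma higher_deriv_bound:
  assumes "f holomorphic_on ball z R" "\<And>w. w \<in> ball z R \<Longrightarrow> cmod (f w) \<le> K" "0 < R"
  shows "cmod ((deriv ^^ n) f z) \<le> fact n * K / (R / 2) ^ n"
\<comment> \<open>The radius is \<open>R / 2\<close> because continuity up to the circle is
  required, while \<open>f\<close> is controlled only on the open ball.\<close>
proof (rule Cauchy_inequality)
  have "cball z (R/2) \<subseteq> ball z R" using assms(3) by auto
  then have "f holomorphic_on cball z (R/2)"
    using assms(1) holomorphic_on_subset by blast
  then show "continuous_on (cball z (R/2)) f" "f holomorphic_on ball z (R/2)"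
    using holomorphic_on_imp_continuous_on holomorphic_on_subset[OF _ ball_subset_cball] by blast+
  show "cmod (f w) \<le> K" if "cmod (z - w) = R / 2" for w
    using assms(2,3) that by (simp add: dist_norm)
qed (use assms in auto)

text \<open>For \<open>w\<close> in the closed disc of radius \<open>R/2\<close> the ball of radius
  \<open>R/2\<close> about \<open>w\<close> stays inside, and \<open>higher_deriv_bound\<close>
  halves once more: the second derivative is at most \<open>2 K / (R/4)^2 = 32 K / R^2\<close>. The
  Taylor bound used divides by \<open>fact 1\<close>, so the constant stays 32.\<close>

lemma scalar_taylor_remainder:
  assumes hol: "f holomorphic_on ball 0 R" and K: "\<And>w. w \<in> ball 0 R \<Longrightarrow> cmod (f w) \<le> K"
    and s: "2 * cmod s \<le> R" "0 < R"
  shows "cmod (f s - f 0 - s * deriv f 0) \<le> 32 * K * (cmod s)\<^sup>2 / R\<^sup>2"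
proof -
  have der: "((deriv ^^ i) f has_field_derivative (deriv ^^ Suc i) f w) (at w within cball 0 (R/2))"
    if "w \<in> cball 0 (R/2)" for w i
  proof -
    have "w \<in> ball 0 R" using that s by auto
    from has_field_derivative_higher_deriv[OF hol open_ball this] show ?thesis
      by (rule has_field_derivative_at_within)
  qed
  have bd: "cmod ((deriv ^^ Suc 1) f w) \<le> 32 * K / R\<^sup>2" if "w \<in> cball 0 (R/2)" for w
  proof -
    have sub: "ball w (R/2) \<subseteq> ball 0 R" using that
      by (simp add: ball_subset_ball_iff)
    have "cmod ((deriv ^^ 2) f w) \<le> fact 2 * K / (R / 2 / 2) ^ 2"
    proof (rule higher_deriv_bound)
      show "f holomorphic_on ball w (R/2)" using hol sub by (rule holomorphic_on_subset)
      show "cmod (f v) \<le> K" if "v \<in> ball w (R/2)" for v using K sub that by blast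
    qed (use s in simp)
    moreover have "fact 2 * K / (R / 2 / 2) ^ 2 = 32 * K / R\<^sup>2"
      by (simp add: power2_eq_square)
    ultimately show ?thesis by (simp add: numeral_2_eq_2)
  qed
  have "cmod ((deriv ^^ 0) f s - (\<Sum>i\<le>1. (deriv ^^ i) f 0 * (s - 0) ^ i / fact i)) 
      \<le> (32 * K / R\<^sup>2) * cmod (s - 0) ^ Suc 1 / fact 1"
    by (rule complex_Taylor[where S="cball 0 (R/2)"]) (use der bd s in auto)
  then show ?thesis by (simp add: algebra_simps power2_eq_square)
qed

section \<open>Derivatives of holomorphic maps are holomorphic\<close>

text \<open>The bridge to one complex variable: since \<open>T\<close> and the derivative are
  complex linear, the real derivative along the slice is multiplication by a complex number.\<close>

lemma has_field_derivative_along_line: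
  fixes f :: "'a::complex_normed_vector \<Rightarrow> 'b::complex_normed_vector" and T :: "'b \<Rightarrow>\<^sub>L complex"
  assumes f: "f cholomorphic_on S" and x: "x + s *\<^sub>C u \<in> S" and T: "complex_linear T"
  shows "((\<lambda>s. T (f (x + s *\<^sub>C u))) has_field_derivative T (fderiv f (x + s *\<^sub>C u) u)) (at s)"
proof -
  have "((\<lambda>s. s *\<^sub>C u) has_derivative (\<lambda>s. s *\<^sub>C u)) (at s)"
    by (intro bounded_linear_imp_has_derivative bounded_linear_intro[where K="norm u"])
      (simp_all add: scaleC_add_left norm_scaleC scaleR_conv_of_real flip: scaleC_scaleC scaleC_of_real)
  then have "((\<lambda>s. x + s *\<^sub>C u) has_derivative (\<lambda>s. s *\<^sub>C u)) (at s)"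
    by (auto intro!: derivative_eq_intros)
  then have "((\<lambda>s. T (f (x + s *\<^sub>C u))) has_derivative (\<lambda>t. T (fderiv f (x + s *\<^sub>C u) (t *\<^sub>C u)))) (at s)"
    by (intro bounded_linear.has_derivative[OF blinfun.bounded_linear_right]
        has_derivative_compose[where f="\<lambda>s. x + s *\<^sub>C u" and g=f, OF _ has_derivative_fderiv[OF f x]])
  moreover have "T (fderiv f (x + s *\<^sub>C u) (t *\<^sub>C u)) = T (fderiv f (x + s *\<^sub>C u) u) * t" for t
    by (simp add: complex_linear_scale[OF T] complex_linear_scale[OF complex_linear_fderiv[OF f x]] scaleC_complex_def)
  ultimately show ?thesis
    unfolding has_field_derivative_def by (simp add: fun_eq_iff)
qed

text \<open>One-variable Cauchy estimates for the slice \<open>T (f (x + s u))\<close>, which is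
  defined for \<open>|s| < R / norm u\<close>. What matters is that the constants do not depend on
  \<open>T\<close>, so that they survive the passage to norms.\<close>

lemma cauchy_estimate_fderiv:
  fixes f :: "'a::complex_normed_vector \<Rightarrow> 'b::complex_normed_vector" and T :: "'b \<Rightarrow>\<^sub>L complex"
  assumes f: "f cholomorphic_on ball x R" and M: "\<And>y. y \<in> ball x R \<Longrightarrow> norm (f y) \<le> M" and "0 < R"
    and T: "complex_linear T" "\<And>y. cmod (T y) \<le> norm y"
  shows "cmod (T (fderiv f x u)) \<le> 2 * M / R * norm u"
    and "2 * (cmod s * norm u) \<le> R \<Longrightarrow>
      cmod (T (f (x + s *\<^sub>C u)) - T (f x) - s * T (fderiv f x u)) \<le> 32 * M / R\<^sup>2 * (cmod s * norm u)\<^sup>2"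
proof -
  define \<psi> where "\<psi> s = T (f (x + s *\<^sub>C u))" for s
  define r where "r = R / norm u"
  have *: "cmod (T (fderiv f x u)) \<le> 2 * M / R * norm u"
    "2 * (cmod s * norm u) \<le> R \<Longrightarrow>
      cmod (\<psi> s - \<psi> 0 - s * T (fderiv f x u)) \<le> 32 * M / R\<^sup>2 * (cmod s * norm u)\<^sup>2"
    if "u \<noteq> 0"
  proof -
    have r: "r > 0" using that \<open>0 < R\<close> by (simp add: r_def)
    have in_ball: "x + s *\<^sub>C u \<in> ball x R" if "s \<in> ball 0 r" for s
      using that \<open>u \<noteq> 0\<close> by (simp add: dist_norm norm_scaleC r_def field_simps)
    have der: "(\<psi> has_field_derivative T (fderiv f (x + s *\<^sub>C u) u)) (at s)" if "s \<in> ball 0 r" for s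
      unfolding \<psi>_def by (rule has_field_derivative_along_line[OF f in_ball[OF that] T(1)])
    have hol: "\<psi> holomorphic_on ball 0 r"
      unfolding holomorphic_on_open[OF open_ball] using der by blast
    have bd: "cmod (\<psi> s) \<le> M" if "s \<in> ball 0 r" for s
      unfolding \<psi>_def using T(2) M[OF in_ball[OF that]] order_trans by blast
    have d0: "deriv \<psi> 0 = T (fderiv f x u)"
      using DERIV_imp_deriv[OF der[of 0]] r by simp
    show "cmod (T (fderiv f x u)) \<le> 2 * M / R * norm u"
      using higher_deriv_bound[OF hol bd r, of 1] \<open>0 < R\<close> \<open>u \<noteq> 0\<close> by (simp add: d0 r_def field_simps)
    assume "2 * (cmod s * norm u) \<le> R"
    then have "2 * cmod s \<le> r" using \<open>u \<noteq> 0\<close> by (simp add: r_def field_simps)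
    from scalar_taylor_remainder[OF hol bd this r]
    show "cmod (\<psi> s - \<psi> 0 - s * T (fderiv f x u)) \<le> 32 * M / R\<^sup>2 * (cmod s * norm u)\<^sup>2"
      using \<open>0 < R\<close> \<open>u \<noteq> 0\<close> by (simp add: d0 r_def power_divide power_mult_distrib)
  qed
  show "cmod (T (fderiv f x u)) \<le> 2 * M / R * norm u"
    using * by (cases "u = 0") simp_all
  show "2 * (cmod s * norm u) \<le> R \<Longrightarrow>
      cmod (T (f (x + s *\<^sub>C u)) - T (f x) - s * T (fderiv f x u)) \<le> 32 * M / R\<^sup>2 * (cmod s * norm u)\<^sup>2"
    using * by (cases "u = 0") (simp_all add: \<psi>_def)
qed

text \<open>Converts scalar bounds that are uniform in \<open>T\<close> into norm bounds, by testing
  with a functional that attains the norm of \<open>y\<close>.\<close>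

lemma norm_le_by_functionals:
  fixes y :: "'a::complex_normed_vector"
  assumes "\<And>T. complex_linear (blinfun_apply T) \<Longrightarrow> (\<And>y. cmod (T y) \<le> norm y) \<Longrightarrow> cmod (T y) \<le> K"
  shows "norm y \<le> K"
proof -
  obtain T :: "'a \<Rightarrow>\<^sub>L complex" where "complex_linear T" "\<And>x. cmod (T x) \<le> norm x" "T y = norm y"
    using complex_hahn_banach[of y] by blast
  then show ?thesis using assms by fastforce
qed

text \<open>The number \<open>d\<close> is the derivative of \<open>T (fderiv f x u)\<close> in the direction \<open>h\<close>. It is the limit of
  difference quotients in the direction \<open>u\<close> of the derivatives in the direction \<open>h\<close>, so it is symmetric in
  \<open>u\<close> and \<open>h\<close>; this gives the additivity in \<open>h\<close>.\<close>

lemma directional_second_derivative: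
  fixes f :: "'a::complex_normed_vector \<Rightarrow> 'b::complex_normed_vector" and T :: "'b \<Rightarrow>\<^sub>L complex"
  assumes f: "f cholomorphic_on ball a (2 * R)" and M: "\<forall>y\<in>ball a (2 * R). norm (f y) \<le> M"
    and "0 < R" and T: "complex_linear T" "\<And>y. cmod (T y) \<le> norm y"
    and \<delta>: "\<And>n. 0 < \<delta> n" "\<And>n. 2 * (\<delta> n * norm u) \<le> R" "\<delta> \<longlonglongrightarrow> 0"
  shows "\<exists>d. (\<lambda>n. T (((1 / \<delta> n) *\<^sub>R (fderiv f (a + \<delta> n *\<^sub>R u) - fderiv f a)) h)) \<longlonglongrightarrow> d \<and>
    (\<forall>s. 2 * (cmod s * norm h) \<le> R \<longrightarrow>
      cmod (T (fderiv f (a + s *\<^sub>C h) u) - T (fderiv f a u) - s * d)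
        \<le> 64 * M / R ^ 3 * norm u * (cmod s * norm h)\<^sup>2) \<and>
    cmod d \<le> 4 * M / R\<^sup>2 * norm u * norm h"
proof (cases "h = 0")
  case True
  show ?thesis by (rule exI[of _ 0]) (use True in simp)
next
  case False
  define \<psi> where "\<psi> s = T (fderiv f (a + s *\<^sub>C h) u)" for s
  define r where "r = R / norm h"
  have r: "r > 0" using False \<open>0 < R\<close> by (simp add: r_def)
  have in_ball: "a + s *\<^sub>C h \<in> ball a R" if "s \<in> ball 0 r" for s
    using that False by (simp add: dist_norm norm_scaleC r_def field_simps)
  have sub: "ball x R \<subseteq> ball a (2 * R)" if "x \<in> ball a R" for x
  proof
    fix y assume "y \<in> ball x R"
    then show "y \<in> ball a (2 * R)" using that dist_triangle[of a y x] by simp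
  qed
  have fx: "f cholomorphic_on ball x R" and Mx: "\<And>y. y \<in> ball x R \<Longrightarrow> norm (f y) \<le> M" if "x \<in> ball a R" for x
    using f M sub[OF that] unfolding cholomorphic_on_def by blast+
  \<comment> \<open>\<open>\<phi> n\<close> is the difference quotient of \<open>T f\<close> in
    direction \<open>u\<close>, as a function on the slice in direction \<open>h\<close>; it tends
    to \<open>\<psi>\<close>. Its derivative \<open>\<phi>' n\<close> at 0 is a difference quotient
    of the derivative in direction \<open>h\<close>. Both displacements are shorter than
    \<open>R\<close>, hence the ball of radius \<open>2 * R\<close>.\<close>
  define \<phi> where "\<phi> n s = (T (f ((a + \<delta> n *\<^sub>R u) + s *\<^sub>C h)) - T (f (a + s *\<^sub>C h))) / \<delta> n" for n s
  define \<phi>' where "\<phi>' n s = (T (fderiv f ((a + \<delta> n *\<^sub>R u) + s *\<^sub>C h) h) - T (fderiv f (a + s *\<^sub>C h) h)) / \<delta> n" for n s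
  have in2: "(a + \<delta> n *\<^sub>R u) + s *\<^sub>C h \<in> ball a (2 * R)" "a + s *\<^sub>C h \<in> ball a (2 * R)" if "s \<in> ball 0 r" for s n
  proof -
    have "norm (\<delta> n *\<^sub>R u) < R" using \<delta>(1,2)[of n] \<open>0 < R\<close> by simp
    moreover have "norm (s *\<^sub>C h) < R" using in_ball[OF that] by (simp add: dist_norm)
    ultimately have "norm (\<delta> n *\<^sub>R u + s *\<^sub>C h) < 2 * R"
      by (intro norm_triangle_lt) simp
    then show "(a + \<delta> n *\<^sub>R u) + s *\<^sub>C h \<in> ball a (2 * R)"
      using dist_add_cancel[of a 0 "\<delta> n *\<^sub>R u + s *\<^sub>C h"] by (simp add: add.assoc)
    show "a + s *\<^sub>C h \<in> ball a (2 * R)" using in_ball[OF that] \<open>0 < R\<close> by simp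
  qed
  have der: "(\<phi> n has_field_derivative \<phi>' n s) (at s)" if "s \<in> ball 0 r" for n s
    unfolding \<phi>_def \<phi>'_def
    by (intro DERIV_cdivide DERIV_diff has_field_derivative_along_line[OF f _ T(1)] in2 that)
  have close: "cmod (\<phi> n s - \<psi> s) \<le> 32 * M / R\<^sup>2 * (norm u)\<^sup>2 * \<delta> n" if "s \<in> ball 0 r" for n s
  proof -
    note x = in_ball[OF that]
    have "cmod (T (f (a + s *\<^sub>C h + complex_of_real (\<delta> n) *\<^sub>C u)) - T (f (a + s *\<^sub>C h)) - complex_of_real (\<delta> n) * \<psi> s)
        \<le> 32 * M / R\<^sup>2 * (cmod (complex_of_real (\<delta> n)) * norm u)\<^sup>2"
      unfolding \<psi>_def using \<delta>(1,2)[of n]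
      by (intro cauchy_estimate_fderiv(2)[OF fx[OF x] Mx[OF x] \<open>0 < R\<close> T]) simp_all
    moreover have "T (f (a + s *\<^sub>C h + complex_of_real (\<delta> n) *\<^sub>C u)) - T (f (a + s *\<^sub>C h)) - complex_of_real (\<delta> n) * \<psi> s
      = complex_of_real (\<delta> n) * (\<phi> n s - \<psi> s)"
      using \<delta>(1)[of n] by (simp add: \<phi>_def scaleC_of_real right_diff_distrib diff_divide_distrib add_ac)
    ultimately have "cmod (complex_of_real (\<delta> n) * (\<phi> n s - \<psi> s)) \<le> 32 * M / R\<^sup>2 * (\<delta> n * norm u)\<^sup>2"
      using \<delta>(1)[of n] by simp
    then have "\<delta> n * cmod (\<phi> n s - \<psi> s) \<le> \<delta> n * (32 * M / R\<^sup>2 * (norm u)\<^sup>2 * \<delta> n)"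
      using \<delta>(1)[of n] unfolding norm_mult by (simp add: power_mult_distrib power2_eq_square mult_ac)
    then show ?thesis unfolding mult_le_cancel_left_pos[OF \<delta>(1)] .
  qed
  have ulim: "uniform_limit (ball 0 r) \<phi> \<psi> sequentially"
  proof -
    have "(\<lambda>n. 32 * M / R\<^sup>2 * (norm u)\<^sup>2 * \<delta> n) \<longlonglongrightarrow> 0"
      using tendsto_mult_right_zero[OF \<delta>(3)] .
    then show ?thesis
      unfolding uniform_limit_iff dist_norm
      by (smt (verit, ccfv_threshold) close eventually_mono order_tendstoD(2) order_le_less_trans)
  qed
  \<comment> \<open>Weierstrass: derivatives of a uniform limit of holomorphic functions converge to
    the derivative of the limit. This exchanges the two differentiations.\<close>
  obtain \<psi>' where \<psi>': "\<And>s. s \<in> ball 0 r \<Longrightarrow> (\<psi> has_field_derivative \<psi>' s) (at s) \<and> (\<lambda>n. \<phi>' n s) \<longlonglongrightarrow> \<psi>' s"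
  proof -
    have "\<exists>d>0. cball x d \<subseteq> ball 0 r \<and> uniform_limit (cball x d) \<phi> \<psi> sequentially" if "x \<in> ball 0 r" for x
      using open_contains_cball[of "ball 0 r"] that uniform_limit_on_subset[OF ulim] by blast
    from has_complex_derivative_uniform_sequence[OF open_ball der this] show ?thesis using that by blast
  qed
  have hol: "\<psi> holomorphic_on ball 0 r"
    unfolding holomorphic_on_open[OF open_ball] using \<psi>' by blast
  have bd: "cmod (\<psi> s) \<le> 2 * M / R * norm u" if "s \<in> ball 0 r" for s
    unfolding \<psi>_def
    using cauchy_estimate_fderiv(1)[OF fx[OF in_ball[OF that]] Mx[OF in_ball[OF that]] \<open>0 < R\<close> T] .
  have d0: "deriv \<psi> 0 = \<psi>' 0"
    using \<psi>'[of 0] r by (auto intro: DERIV_imp_deriv)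
  show ?thesis
  proof (intro exI[of _ "\<psi>' 0"] conjI allI impI)
    have "\<phi>' n 0 = T (((1 / \<delta> n) *\<^sub>R (fderiv f (a + \<delta> n *\<^sub>R u) - fderiv f a)) h)" for n
      by (simp add: \<phi>'_def blinfun.bilinear_simps scaleR_conv_of_real divide_simps)
    then show "(\<lambda>n. T (((1 / \<delta> n) *\<^sub>R (fderiv f (a + \<delta> n *\<^sub>R u) - fderiv f a)) h)) \<longlonglongrightarrow> \<psi>' 0"
      using \<psi>'[of 0] r by simp
    show "cmod (\<psi>' 0) \<le> 4 * M / R\<^sup>2 * norm u * norm h"
      using higher_deriv_bound[OF hol bd r, of 1] \<open>0 < R\<close> False
      by (simp add: d0 r_def field_simps power2_eq_square)
    fix s assume "2 * (cmod s * norm h) \<le> R"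
    then have s_le: "2 * cmod s \<le> r" using False by (simp add: r_def field_simps)
    have eq: "32 * (2 * M / R * norm u) * (cmod s)\<^sup>2 / r\<^sup>2 = 64 * M / R ^ 3 * norm u * (cmod s * norm h)\<^sup>2"
      using \<open>0 < R\<close> False by (simp add: r_def field_simps eval_nat_numeral)
    from scalar_taylor_remainder[OF hol bd s_le r]
    show "cmod (T (fderiv f (a + s *\<^sub>C h) u) - T (fderiv f a u) - s * \<psi>' 0)
        \<le> 64 * M / R ^ 3 * norm u * (cmod s * norm h)\<^sup>2"
      unfolding d0 eq by (simp add: \<psi>_def)
  qed
qed

text \<open>The operator space is again a complex Banach space, so the theorem applies to its own
  conclusion and yields derivatives of every order. The difference quotients \<open>D h n\<close>
  are Cauchy in operator norm; their limits \<open>B h\<close> form the derivative, with a remainder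
  quadratic in \<open>h\<close>.\<close>

theorem cholomorphic_on_fderiv:
  fixes f :: "'a::complex_normed_vector \<Rightarrow> 'b::complex_banach"
  assumes f: "f cholomorphic_on S" and "open S"
  shows "fderiv f cholomorphic_on S"
proof -
  have "\<exists>B. (fderiv f has_derivative B) (at a) \<and> complex_linear B" if "a \<in> S" for a
  proof -
    \<comment> \<open>Closed balls need not be compact, so the bound \<open>M\<close> comes from
      continuity at \<open>a\<close>, at the price of a small radius.\<close>
    have "isCont f a"
      using has_derivative_continuous[OF has_derivative_fderiv[OF f that]] .
    then have "\<forall>\<^sub>F y in nhds a. norm (f y) < norm (f a) + 1 \<and> y \<in> S"
      using order_tendstoD(2)[OF tendsto_norm[of f "f a" "nhds a"], of "norm (f a) + 1"]
        eventually_nhds_in_open[OF \<open>open S\<close> that]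
      by (auto simp: isCont_def tendsto_at_iff_tendsto_nhds eventually_conj_iff)
    then obtain R2 where R2: "R2 > 0" "\<And>y. dist y a < R2 \<Longrightarrow> norm (f y) < norm (f a) + 1 \<and> y \<in> S"
      unfolding eventually_nhds_metric by blast
    define R where "R = R2 / 2"
    define M where "M = norm (f a) + 1"
    have R: "R > 0" using R2 by (simp add: R_def)
    have M: "\<forall>y\<in>ball a (2 * R). norm (f y) \<le> M"
      using R2(2) by (simp add: R_def M_def dist_commute less_imp_le)
    have fR: "f cholomorphic_on ball a (2 * R)"
      using R2(2) f unfolding cholomorphic_on_def R_def by (simp add: dist_commute)
    have M0: "M > 0" by (simp add: M_def add_nonneg_pos)
    define C where "C = 64 * M / R ^ 3"
    have C: "C > 0" using R M0 by (simp add: C_def)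
    \<comment> \<open>The factor \<open>1 / (2 * (norm h + 1))\<close> keeps the displacement below
      \<open>R / 2\<close>, also for \<open>h = 0\<close>, and \<open>1 / Suc n\<close> sends the
      steps to 0.\<close>
    define \<delta> where "\<delta> h n = R / (2 * (norm h + 1)) / real (Suc n)" for h :: 'a and n
    have \<delta>0: "\<delta> h n > 0" for h n
      using R by (simp add: \<delta>_def add_nonneg_pos)
    have \<delta>R: "2 * (\<delta> h n * norm h) \<le> R" for h n
    proof -
      define k where "k = (norm h + 1) * real (Suc n)"
      have "k > 0" "norm h \<le> k"
        using mult_mono[of "norm h" "norm h + 1" 1 "real (Suc n)"] by (simp_all add: k_def add_nonneg_pos)
      then have "R * (norm h / k) \<le> R * 1"
        using R by (intro mult_left_mono) auto
      moreover have "2 * (\<delta> h n * norm h) = R * (norm h / k)"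
        unfolding \<delta>_def k_def by (simp add: mult.assoc del: of_nat_Suc distrib_left_numeral)
      ultimately show ?thesis by simp
    qed
    have \<delta>lim: "\<delta> h \<longlonglongrightarrow> 0" for h
      unfolding \<delta>_def[abs_def] divide_inverse[of _ "real (Suc _)"]
      by (intro tendsto_mult_right_zero LIMSEQ_inverse_real_of_nat)
    define D where "D h n = (1 / \<delta> h n) *\<^sub>R (fderiv f (a + \<delta> h n *\<^sub>R h) - fderiv f a)" for h n
    \<comment> \<open>One number \<open>d\<close> is the limit both of \<open>T (D u n h)\<close>
      and of \<open>T (D h n u)\<close>. It depends on \<open>T\<close>, \<open>u\<close> and
      \<open>h\<close>, but the constants in the estimates do not depend on
      \<open>T\<close>.\<close>
    have key: "\<exists>d. (\<lambda>n. T (D u n h)) \<longlonglongrightarrow> d \<and>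
        (\<forall>s. 2 * (cmod s * norm h) \<le> R \<longrightarrow>
          cmod (T (fderiv f (a + s *\<^sub>C h) u) - T (fderiv f a u) - s * d) \<le> C * norm u * (cmod s * norm h)\<^sup>2) \<and>
        cmod d \<le> 4 * M / R\<^sup>2 * norm u * norm h \<and>
        (\<forall>n. cmod (T (D h n u) - d) \<le> C * norm u * (norm h)\<^sup>2 * \<delta> h n)"
      if T: "complex_linear T" "\<And>y. cmod (T y) \<le> norm y" for T :: "'b \<Rightarrow>\<^sub>L complex" and u h
    proof -
      obtain d where d: "(\<lambda>n. T (D u n h)) \<longlonglongrightarrow> d"
        "\<forall>s. 2 * (cmod s * norm h) \<le> R \<longrightarrow>
          cmod (T (fderiv f (a + s *\<^sub>C h) u) - T (fderiv f a u) - s * d) \<le> C * norm u * (cmod s * norm h)\<^sup>2"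
        "cmod d \<le> 4 * M / R\<^sup>2 * norm u * norm h"
        using directional_second_derivative[where \<delta>="\<delta> u" and u=u and h=h, OF fR M R T \<delta>0 \<delta>R \<delta>lim]
        unfolding D_def C_def by (elim exE conjE)
      have "cmod (T (D h n u) - d) \<le> C * norm u * (norm h)\<^sup>2 * \<delta> h n" for n
      proof -
        define e where "e = complex_of_real (\<delta> h n)"
        have "cmod (T (fderiv f (a + e *\<^sub>C h) u) - T (fderiv f a u) - e * d) \<le> C * norm u * (cmod e * norm h)\<^sup>2"
          using \<delta>0[of h n] \<delta>R[of h n] by (intro d(2)[rule_format]) (simp add: e_def)
        moreover have "T (fderiv f (a + e *\<^sub>C h) u) - T (fderiv f a u) - e * d = e * (T (D h n u) - d)"
          using \<delta>0[of h n]
          by (simp add: D_def e_def scaleC_of_real blinfun.bilinear_simps scaleR_conv_of_real 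
              right_diff_distrib diff_divide_distrib)
        ultimately have "\<delta> h n * cmod (T (D h n u) - d) \<le> C * norm u * (\<delta> h n * norm h)\<^sup>2"
          using \<delta>0[of h n] by (simp add: norm_mult e_def)
        also have "\<dots> = \<delta> h n * (C * norm u * (norm h)\<^sup>2 * \<delta> h n)"
          by (simp add: power2_eq_square mult_ac)
        finally show ?thesis unfolding mult_le_cancel_left_pos[OF \<delta>0] .
      qed
      then show ?thesis by (intro exI[of _ d] conjI d allI)
    qed
    \<comment> \<open>\<open>d\<close> serves only as a common reference point and drops out. The
      bound is uniform in \<open>T\<close> and linear in \<open>norm u\<close>, hence a bound in
      operator norm; completeness of the operator space then gives \<open>B h\<close>.\<close>
    have cauchy: "norm (D h n - D h m) \<le> C * (norm h)\<^sup>2 * (\<delta> h n + \<delta> h m)" for h n m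
    proof (rule norm_blinfun_bound)
      show "norm ((D h n - D h m) u) \<le> C * (norm h)\<^sup>2 * (\<delta> h n + \<delta> h m) * norm u" for u
      proof (rule norm_le_by_functionals)
        fix T :: "'b \<Rightarrow>\<^sub>L complex" assume T: "complex_linear T" "\<And>y. cmod (T y) \<le> norm y"
        obtain d where d: "\<And>n. cmod (T (D h n u) - d) \<le> C * norm u * (norm h)\<^sup>2 * \<delta> h n"
          using key[OF T] by blast
        have "cmod (T (D h n u) - T (D h m u)) \<le> cmod (T (D h n u) - d) + cmod (T (D h m u) - d)"
          using norm_triangle_ineq4[of "T (D h n u) - d" "T (D h m u) - d"] by simp
        then show "cmod (T ((D h n - D h m) u)) \<le> C * (norm h)\<^sup>2 * (\<delta> h n + \<delta> h m) * norm u"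
          using d[of n] d[of m] by (simp add: blinfun.bilinear_simps algebra_simps)
      qed
    qed (use C \<delta>0 in \<open>simp add: add_nonneg_nonneg less_imp_le\<close>)
    have "Cauchy (D h)" for h
    proof (rule CauchyI)
      fix e :: real assume "e > 0"
      have "(\<lambda>n. C * (norm h)\<^sup>2 * \<delta> h n) \<longlonglongrightarrow> 0"
        using tendsto_mult_right_zero[OF \<delta>lim] .
      then have "\<forall>\<^sub>F n in sequentially. C * (norm h)\<^sup>2 * \<delta> h n < e / 2"
        using \<open>e > 0\<close> by (intro order_tendstoD) auto
      then obtain N where N: "\<And>n. n \<ge> N \<Longrightarrow> C * (norm h)\<^sup>2 * \<delta> h n < e / 2"
        unfolding eventually_sequentially by blast
      show "\<exists>N. \<forall>m\<ge>N. \<forall>n\<ge>N. norm (D h m - D h n) < e"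
      proof (intro exI allI impI)
        fix m n assume "N \<le> m" "N \<le> n"
        then show "norm (D h m - D h n) < e"
          using cauchy[of h m n] N[of m] N[of n] by (simp add: distrib_left)
      qed
    qed
    then obtain B where B: "\<And>h. D h \<longlonglongrightarrow> B h"
      unfolding convergent_eq_Cauchy[symmetric] by metis
    have B_eq: "T (B h u) = d" 
      if T: "complex_linear T" and d: "\<And>n. cmod (T (D h n u) - d) \<le> C * norm u * (norm h)\<^sup>2 * \<delta> h n"
      for T :: "'b \<Rightarrow>\<^sub>L complex" and h u d
    proof -
      have "(\<lambda>n. T (D h n u)) \<longlonglongrightarrow> T (B h u)"
        by (intro tendsto_intros B)
      moreover have "(\<lambda>n. T (D h n u)) \<longlonglongrightarrow> d"
        using Lim_null_comparison[of "\<lambda>n. T (D h n u) - d" "\<lambda>n. C * norm u * (norm h)\<^sup>2 * \<delta> h n" sequentially]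
          d tendsto_mult_right_zero[OF \<delta>lim]
        by (subst LIM_zero_iff[symmetric]) auto
      ultimately show ?thesis by (rule LIMSEQ_unique)
    qed
    have sym: "B h u = B u h" for h u
    proof -
      have "norm (B h u - B u h) \<le> 0"
      proof (rule norm_le_by_functionals)
        fix T :: "'b \<Rightarrow>\<^sub>L complex" assume T: "complex_linear T" "\<And>y. cmod (T y) \<le> norm y"
        obtain d where d: "(\<lambda>n. T (D u n h)) \<longlonglongrightarrow> d"
            "\<And>n. cmod (T (D h n u) - d) \<le> C * norm u * (norm h)\<^sup>2 * \<delta> h n"
          using key[OF T] by blast
        have "(\<lambda>n. T (D u n h)) \<longlonglongrightarrow> T (B u h)"
          by (intro tendsto_intros B)
        then show "cmod (T (B h u - B u h)) \<le> 0"
          using LIMSEQ_unique d(1) B_eq[OF T(1) d(2)] by (simp add: blinfun.bilinear_simps)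
      qed
      then show ?thesis by simp
    qed
    have lin: "complex_linear (B h)" for h
    proof -
      have D_scale: "D h n (c *\<^sub>C x) = c *\<^sub>C D h n x" for n c x
      proof -
        have "a + \<delta> h n *\<^sub>R h \<in> S" "a \<in> S"
          using R2(2)[of "a + \<delta> h n *\<^sub>R h"] \<delta>0[of h n] \<delta>R[of h n] R \<open>a \<in> S\<close> by (auto simp: R_def dist_norm)
        then have "fderiv f (a + \<delta> h n *\<^sub>R h) (c *\<^sub>C x) = c *\<^sub>C fderiv f (a + \<delta> h n *\<^sub>R h) x"
          "fderiv f a (c *\<^sub>C x) = c *\<^sub>C fderiv f a x"
          using complex_linear_scale[OF complex_linear_fderiv[OF f]] by blast+
        then show ?thesis
          unfolding D_def
          by (simp add: blinfun.bilinear_simps linear_diff[OF bounded_linear.linear[OF bounded_linear_scaleC_right]]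
              linear_scale[OF bounded_linear.linear[OF bounded_linear_scaleC_right]])
      qed
      have "B h (c *\<^sub>C x) = c *\<^sub>C B h x" for c x
      proof (rule LIMSEQ_unique)
        show "(\<lambda>n. D h n (c *\<^sub>C x)) \<longlonglongrightarrow> B h (c *\<^sub>C x)"
          by (intro tendsto_intros B)
        show "(\<lambda>n. D h n (c *\<^sub>C x)) \<longlonglongrightarrow> c *\<^sub>C B h x"
          unfolding D_scale by (intro bounded_linear.tendsto[OF bounded_linear_scaleC_right] tendsto_intros B)
      qed
      then show ?thesis by (simp add: complex_linear_def blinfun.bilinear_simps)
    qed
    \<comment> \<open>Linearity in the second argument is known: each \<open>B h\<close> is an
      operator, complex linear by \<open>lin\<close>. Symmetry carries it over to the dependence on
      \<open>h\<close>, where the difference quotients say nothing directly.\<close>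
    have linB: "complex_linear B"
      unfolding complex_linear_def
    proof (intro conjI allI blinfun_eqI)
      show "B (x + y) u = (B x + B y) u" for x y u
        using sym by (simp add: blinfun.bilinear_simps)
      show "B (c *\<^sub>C x) u = (c *\<^sub>C B x) u" for c x u
        using sym complex_linear_scale[OF lin] by simp
    qed
    have bdB: "norm (B h) \<le> norm h * (4 * M / R\<^sup>2)" for h
    proof (rule norm_blinfun_bound)
      show "norm (B h u) \<le> norm h * (4 * M / R\<^sup>2) * norm u" for u
      proof (rule norm_le_by_functionals)
        fix T :: "'b \<Rightarrow>\<^sub>L complex" assume T: "complex_linear T" "\<And>y. cmod (T y) \<le> norm y"
        obtain d where d: "cmod d \<le> 4 * M / R\<^sup>2 * norm u * norm h"
            "\<And>n. cmod (T (D h n u) - d) \<le> C * norm u * (norm h)\<^sup>2 * \<delta> h n"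
          using key[OF T] by blast
        show "cmod (T (B h u)) \<le> norm h * (4 * M / R\<^sup>2) * norm u"
          using d(1) unfolding B_eq[OF T(1) d(2)] by (simp add: mult_ac)
      qed
    qed (use M0 in simp)
    have rem: "norm (fderiv f (a + h) - fderiv f a - B h) \<le> C * (norm h)\<^sup>2" if h: "2 * norm h \<le> R" for h
    proof (rule norm_blinfun_bound)
      show "norm ((fderiv f (a + h) - fderiv f a - B h) u) \<le> C * (norm h)\<^sup>2 * norm u" for u
      proof (rule norm_le_by_functionals)
        fix T :: "'b \<Rightarrow>\<^sub>L complex" assume T: "complex_linear T" "\<And>y. cmod (T y) \<le> norm y"
        obtain d where d: "\<And>s. 2 * (cmod s * norm h) \<le> R \<Longrightarrow>
            cmod (T (fderiv f (a + s *\<^sub>C h) u) - T (fderiv f a u) - s * d) \<le> C * norm u * (cmod s * norm h)\<^sup>2"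
            "\<And>n. cmod (T (D h n u) - d) \<le> C * norm u * (norm h)\<^sup>2 * \<delta> h n"
          using key[OF T] by blast
        show "cmod (T ((fderiv f (a + h) - fderiv f a - B h) u)) \<le> C * (norm h)\<^sup>2 * norm u"
          using d(1)[of 1] h B_eq[OF T(1) d(2)] by (simp add: blinfun.bilinear_simps scaleC_one mult_ac)
      qed
    qed (use C in simp)
    have "bounded_linear B"
    proof (rule bounded_linear_intro)
      show "B (x + y) = B x + B y" for x y
        by (rule complex_linear_add[OF linB])
      show "B (r *\<^sub>R x) = r *\<^sub>R B x" for r x
        using complex_linear_scale[OF linB, of "complex_of_real r"] by (simp add: scaleC_of_real)
    qed (rule bdB)
    moreover have "(\<lambda>h. norm (fderiv f (a + h) - fderiv f a - B h) / norm h) \<midarrow>0\<rightarrow> 0"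
    proof (rule Lim_null_comparison)
      show "\<forall>\<^sub>F h in at 0. norm (norm (fderiv f (a + h) - fderiv f a - B h) / norm h) \<le> C * norm h"
        unfolding eventually_at
      proof (intro exI conjI ballI impI)
        show "R / 2 > 0" using R by simp
        fix h :: 'a assume "h \<noteq> 0 \<and> dist h 0 < R / 2"
        then show "norm (norm (fderiv f (a + h) - fderiv f a - B h) / norm h) \<le> C * norm h"
          using rem[of h] by (simp add: divide_le_eq power2_eq_square mult_ac)
      qed
      show "((\<lambda>h. C * norm h) \<longlongrightarrow> 0) (at (0::'a))"
        by (intro tendsto_mult_right_zero tendsto_norm_zero tendsto_ident_at)
    qed
    ultimately have "(fderiv f has_derivative B) (at a)"
      unfolding has_derivative_at by blast
    then show ?thesis using linB by blast
  qed
  then show ?thesis unfolding cholomorphic_on_def by blast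
qed

section \<open>Coefficients of functions with positive real part\<close>

text \<open>The mean of \<open>Re p\<close> times the nonnegative trigonometric polynomial over the
  circle of radius \<open>r < 1\<close> is nonnegative, and Cauchy's formula expresses it through
  the coefficients. Then \<open>r\<close> tends to 1, as nothing is assumed about \<open>p\<close>
  on the unit circle.\<close>

lemma caratheodory_trig_nonneg:
  assumes hol: "p holomorphic_on ball 0 1" and p0: "p 0 = 1" and pos: "\<And>z. z \<in> ball 0 1 \<Longrightarrow> 0 \<le> Re (p z)"
    and K: "\<And>t. 0 \<le> k0 + k1 * cos t + k3 * cos (3 * t)"
  shows "0 \<le> k0 + k1 * (Re ((deriv ^^ 1) p 0 / fact 1) / 2) + k3 * (Re ((deriv ^^ 3) p 0 / fact 3) / 2)"
proof -
  define P where "P n = (deriv ^^ n) p 0 / fact n" for n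
  have main: "0 \<le> k0 + k1 * (r * Re (P 1) / 2) + k3 * (r ^ 3 * Re (P 3) / 2)" if r: "0 < r" "r < 1" for r
  proof -
    have sub: "cball 0 r \<subseteq> ball (0::complex) 1" using r by auto
    have contp: "continuous_on (cball 0 r) p" and holp: "p holomorphic_on ball 0 r"
      using holomorphic_on_subset[OF hol sub] holomorphic_on_imp_continuous_on
        holomorphic_on_subset[OF _ ball_subset_cball] by blast+
    have neg: "((\<lambda>z. p z / z ^ Suc n) has_contour_integral (2 * pi * \<i>) * P n) (circlepath 0 r)" for n
      using Cauchy_has_contour_integral_higher_derivative_circlepath[OF contp holp, of 0 n] r
      by (simp add: P_def)
    have posi: "((\<lambda>z. p z * z ^ n) has_contour_integral 0) (circlepath 0 r)" for n
    proof (rule Cauchy_theorem_convex_simple[of _ "ball 0 1"])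
      show "(\<lambda>z. p z * z ^ n) holomorphic_on ball 0 1" using hol by (intro holomorphic_intros)
      show "path_image (circlepath 0 r) \<subseteq> ball 0 1" using r by (auto simp: path_image_circlepath)
    qed auto
    \<comment> \<open>On \<open>z = r e\<close> with \<open>e = exp (i t)\<close> one has
      \<open>cos (n t) = ((z/r)^n + (r/z)^n) / 2\<close>, so \<open>z * H z\<close> is
      \<open>p z\<close> times the polynomial. The half with positive powers integrates to 0, which
      leaves the factors 1/2 of the conclusion.\<close>
    define H where "H z = k0 * (p z / z ^ Suc 0)
       + (k1 / (2 * r) * (p z * z ^ 0) + k1 * r / 2 * (p z / z ^ Suc 1))
       + (k3 / (2 * r ^ 3) * (p z * z ^ 2) + k3 * r ^ 3 / 2 * (p z / z ^ Suc 3))" for z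
    define I where "I = k0 + k1 * r / 2 * P 1 + k3 * r ^ 3 / 2 * P 3"
    have "(H has_contour_integral (k0 * (2 * pi * \<i> * P 0)
       + (complex_of_real (k1 / (2 * r)) * 0 + k1 * r / 2 * (2 * pi * \<i> * P 1))
       + (complex_of_real (k3 / (2 * r ^ 3)) * 0 + k3 * r ^ 3 / 2 * (2 * pi * \<i> * P 3)))) (circlepath 0 r)"
      unfolding H_def by (intro has_contour_integral_add has_contour_integral_lmul neg posi)
    also have "(k0 * (2 * pi * \<i> * P 0)
       + (complex_of_real (k1 / (2 * r)) * 0 + k1 * r / 2 * (2 * pi * \<i> * P 1))
       + (complex_of_real (k3 / (2 * r ^ 3)) * 0 + k3 * r ^ 3 / 2 * (2 * pi * \<i> * P 3))) = 2 * pi * \<i> * I"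
      by (simp add: I_def P_def p0 algebra_simps)
    finally have "((\<lambda>x. H (circlepath 0 r x) * vector_derivative (circlepath 0 r) (at x within {0..1}))
        has_integral 2 * pi * \<i> * I) {0..1}"
      unfolding has_contour_integral_def .
    then have "((\<lambda>x. (2 * pi * \<i>) * (p (circlepath 0 r x) * 
        complex_of_real (k0 + k1 * cos (2 * pi * x) + k3 * cos (3 * (2 * pi * x))))) has_integral 2 * pi * \<i> * I) {0..1}"
    proof (rule has_integral_eq[rotated])
      fix x :: real assume x: "x \<in> {0..1}"
      define e where "e = exp (\<i> * complex_of_real (2 * pi * x))"
      have e0: "e \<noteq> 0" by (simp add: e_def)
      have c1: "cos (complex_of_real (2 * pi * x)) = (e + 1 / e) / 2"
        by (simp add: cos_exp_eq e_def exp_minus inverse_eq_divide)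
      have c3: "cos (complex_of_real (3 * (2 * pi * x))) = (e ^ 3 + 1 / e ^ 3) / 2"
        by (simp add: cos_exp_eq e_def exp_minus inverse_eq_divide flip: exp_of_nat_mult)
          (simp add: mult_ac)
      have g: "circlepath 0 r x = r * e"
        by (simp add: circlepath e_def mult_ac)
      have v: "vector_derivative (circlepath 0 r) (at x within {0..1}) = 2 * pi * \<i> * (r * e)"
        using vector_derivative_circlepath01[of x 0 r] x by (simp add: e_def mult_ac)
      have "H (r * e) * (r * e) = p (r * e) * (k0 + k1 * ((e + 1 / e) / 2) + k3 * ((e ^ 3 + 1 / e ^ 3) / 2))"
        using e0 r(1) by (simp add: H_def field_simps eval_nat_numeral)
      moreover have "H (r * e) * (2 * pi * \<i> * (r * e)) = 2 * pi * \<i> * (H (r * e) * (r * e))"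
        by (simp only: mult_ac)
      ultimately show "H (circlepath 0 r x) * vector_derivative (circlepath 0 r) (at x within {0..1})
        = (2 * pi * \<i>) * (p (circlepath 0 r x) * complex_of_real (k0 + k1 * cos (2 * pi * x) + k3 * cos (3 * (2 * pi * x))))"
        unfolding g v of_real_add of_real_mult[of k1] of_real_mult[of k3] cos_of_real[symmetric] c1 c3
        by (simp only:)
    qed
    from has_integral_mult_right[OF this, of "1 / (2 * pi * \<i>)"]
    have "((\<lambda>x. p (circlepath 0 r x) * 
        complex_of_real (k0 + k1 * cos (2 * pi * x) + k3 * cos (3 * (2 * pi * x)))) has_integral I) {0..1}"
      by simp
    from has_integral_linear[OF this bounded_linear_Re]
    have "((\<lambda>x. Re (p (circlepath 0 r x)) * (k0 + k1 * cos (2 * pi * x) + k3 * cos (3 * (2 * pi * x)))) has_integral Re I) {0..1}"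
      by (simp add: o_def)
    then have "0 \<le> Re I"
    proof (rule has_integral_nonneg)
      fix x :: real
      have "circlepath 0 r x \<in> ball 0 1"
        using r by (simp add: circlepath norm_mult)
      then show "0 \<le> Re (p (circlepath 0 r x)) * (k0 + k1 * cos (2 * pi * x) + k3 * cos (3 * (2 * pi * x)))"
        by (intro mult_nonneg_nonneg pos K)
    qed
    then show ?thesis by (simp add: I_def mult_ac flip: of_real_mult of_real_power)
  qed
  have "((\<lambda>r. k0 + k1 * (r * Re (P 1) / 2) + k3 * (r ^ 3 * Re (P 3) / 2)) \<longlongrightarrow>
      k0 + k1 * (1 * Re (P 1) / 2) + k3 * (1 ^ 3 * Re (P 3) / 2)) (at_left 1)"
    by (intro tendsto_intros) auto
  moreover have "\<forall>\<^sub>F r in at_left 1. 0 \<le> k0 + k1 * (r * Re (P 1) / 2) + k3 * (r ^ 3 * Re (P 3) / 2)"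
    using eventually_at_left_real[OF zero_less_one] by (rule eventually_mono) (rule main, auto)
  ultimately have "0 \<le> k0 + k1 * (1 * Re (P 1) / 2) + k3 * (1 ^ 3 * Re (P 3) / 2)"
    by (intro tendsto_lowerbound[where F="at_left 1"]) auto
  then show ?thesis by (simp add: P_def)
qed

text \<open>With \<open>v = s a\<close> this is \<open>3 v - 4 v^3 <= 1\<close>, whose defect
  factors with a double root at \<open>v = 1/2\<close>. Equality at \<open>a = 1/(2s)\<close> is
  what the extremal angle uses.\<close>

lemma cubic_le_inverse:
  fixes a s :: real
  assumes "0 \<le> a" "0 < s"
  shows "3 * a - 4 * s\<^sup>2 * a ^ 3 \<le> 1 / s"
proof -
  define v where "v = s * a"
  have "0 \<le> (v + 1) * (2 * v - 1)\<^sup>2" using assms by (simp add: v_def)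
  also have "\<dots> = 1 - (3 * v - 4 * v ^ 3)"
    by (simp add: power2_eq_square power3_eq_cube algebra_simps)
  finally have "3 * v - 4 * v ^ 3 \<le> 1" by simp
  then have "s * (3 * a - 4 * s\<^sup>2 * a ^ 3) \<le> 1"
    by (simp add: v_def power2_eq_square power3_eq_cube algebra_simps)
  then show ?thesis using assms(2) by (simp add: field_simps)
qed

text \<open>Here \<open>a\<close> and \<open>m\<close> stand for half the real parts of the rotated
  \<open>p_1\<close> and \<open>p_3\<close>. The hypothesis is sharpest at \<open>A = a\<close>,
  where it reads \<open>- m <= 3a - 4a^3\<close>; for \<open>a <= 1/2\<close> the best admissible
  choice is \<open>A = 1/2\<close>, which gives \<open>- m <= 1\<close>.\<close>

lemma cubic_le_J23_bound:
  fixes a \<beta> m :: real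
  assumes \<beta>: "0 < \<beta>" "\<beta> \<le> 1" and a: "0 \<le> a" "a \<le> 1"
    and m: "\<And>A. 1 / 2 \<le> A \<Longrightarrow> 0 \<le> 8 * A ^ 3 + (3 - 12 * A\<^sup>2) * a + m"
  shows "\<beta> / 3 * (8 * \<beta>\<^sup>2 * a ^ 3 - 2 * m) \<le> J23_bound (1 - \<beta>)"
proof -
  define s where "s = sqrt (1 - \<beta>\<^sup>2)"
  have s2: "s\<^sup>2 = 1 - \<beta>\<^sup>2" using \<beta> power_le_one[of \<beta> 2] by (simp add: s_def)
  have s0: "0 \<le> s" using \<beta> power_le_one[of \<beta> 2] by (simp add: s_def)
  have cond: "1 - \<beta> \<le> 1 - sqrt 3 / 2 \<longleftrightarrow> 3 / 4 \<le> \<beta>\<^sup>2"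
  proof -
    have "sqrt 3 / 2 \<le> \<beta> \<longleftrightarrow> (sqrt 3 / 2)\<^sup>2 \<le> \<beta>\<^sup>2"
      using \<beta> by (intro power_mono_iff[symmetric]) auto
    then show ?thesis by (simp add: power_divide)
  qed
  have goal: "4 * \<beta>\<^sup>2 * a ^ 3 - m \<le> (if 3 / 4 \<le> \<beta>\<^sup>2 then 4 * \<beta>\<^sup>2 - 1 else 1 / s)"
  proof (cases "a \<le> 1 / 2")
    case True
    have "a ^ 3 \<le> (1/2) ^ 3" using a True by (intro power_mono) auto
    then have "4 * \<beta>\<^sup>2 * a ^ 3 \<le> 4 * \<beta>\<^sup>2 * (1/8)"
      by (intro mult_left_mono) (auto simp: power3_eq_cube)
    moreover have "- m \<le> 1" using m[of "1/2"] by (simp add: power2_eq_square power3_eq_cube)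
    ultimately have le: "4 * \<beta>\<^sup>2 * a ^ 3 - m \<le> 1 + \<beta>\<^sup>2 / 2" by simp
    show ?thesis
    proof (cases "3 / 4 \<le> \<beta>\<^sup>2")
      case False
      then have "0 < s" using s0 s2 by (cases "s = 0") auto
      have "1 + \<beta>\<^sup>2 / 2 \<le> 1 / s"
      proof -
        \<comment> \<open>The claim is \<open>s^3 - 3 s + 2 >= 0\<close>, and \<open>s = 1\<close>
          is a double root of this cubic.\<close>
        have "0 \<le> (1 - s)\<^sup>2 * (s + 2)" using s0 by simp
        also have "\<dots> = 2 - s * (2 + (1 - s\<^sup>2))"
          by (simp add: power2_eq_square algebra_simps)
        finally have "s * (1 + \<beta>\<^sup>2 / 2) \<le> 1" using s2 by (simp add: algebra_simps)
        then show ?thesis using \<open>0 < s\<close> by (simp add: field_simps)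
      qed
      then show ?thesis using le False by simp
    qed (use le in simp)
  next
    case False
    have "- m \<le> 3 * a - 4 * a ^ 3" using m[of a] False by (simp add: power2_eq_square power3_eq_cube algebra_simps)
    then have le: "4 * \<beta>\<^sup>2 * a ^ 3 - m \<le> 3 * a - 4 * s\<^sup>2 * a ^ 3"
      unfolding s2 by (simp add: algebra_simps)
    show ?thesis
    proof (cases "3 / 4 \<le> \<beta>\<^sup>2")
      case True
      \<comment> \<open>Now \<open>s^2 <= 1/4\<close>, and the comparison with the value at the
        endpoint \<open>a = 1\<close> has the factor \<open>1 - a\<close>; the cofactor is
        nonnegative because \<open>1 + a + a^2 <= 3\<close>.\<close>
      have "s\<^sup>2 * (1 + a + a\<^sup>2) \<le> 1 / 4 * 3"
        using s2 True a power_le_one[of a 2] by (intro mult_mono) auto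
      then have "0 \<le> (1 - a) * (3 - 4 * (s\<^sup>2 * (1 + a + a\<^sup>2)))"
        using a by (intro mult_nonneg_nonneg) auto
      also have "\<dots> = (3 - 4 * s\<^sup>2) - (3 * a - 4 * s\<^sup>2 * a ^ 3)"
        by (simp add: power2_eq_square power3_eq_cube algebra_simps)
      finally show ?thesis using le True s2 by simp
    next
      case False
      then have "0 < s" using s0 s2 by (cases "s = 0") auto
      from cubic_le_inverse[OF a(1) this] le False show ?thesis by simp
    qed
  qed
  have "\<beta> / 3 * (8 * \<beta>\<^sup>2 * a ^ 3 - 2 * m) = 2 / 3 * \<beta> * (4 * \<beta>\<^sup>2 * a ^ 3 - m)"
    by (simp add: algebra_simps)
  also have "\<dots> \<le> 2 / 3 * \<beta> * (if 3 / 4 \<le> \<beta>\<^sup>2 then 4 * \<beta>\<^sup>2 - 1 else 1 / s)"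
    using goal \<beta> by (intro mult_left_mono) auto
  also have "\<dots> = J23_bound (1 - \<beta>)"
    unfolding J23_bound_def cond by (simp add: s_def)
  finally show ?thesis .
qed

text \<open>Replacing \<open>p z\<close> by \<open>p (u z)\<close> multiplies \<open>p_n\<close> by
  \<open>u^n\<close>, so both terms acquire the same factor \<open>u^3\<close>. Fixing the phase of
  the difference leaves \<open>u\<close> free up to a cube root of unity, which is just enough to
  make \<open>Re (u p_1)\<close> nonnegative.\<close>

lemma caratheodory_coeff_bound:
  assumes hol: "p holomorphic_on ball 0 1" and p0: "p 0 = 1" and pos: "\<And>z. z \<in> ball 0 1 \<Longrightarrow> 0 \<le> Re (p z)"
    and \<beta>: "0 < \<beta>" "\<beta> \<le> 1"
  shows "\<beta> / 3 * cmod (\<beta>\<^sup>2 * ((deriv ^^ 1) p 0 / fact 1) ^ 3 - (deriv ^^ 3) p 0 / fact 3) \<le> J23_bound (1 - \<beta>)"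
proof -
  define P where "P n = (deriv ^^ n) p 0 / fact n" for n
  define c where "c = complex_of_real (\<beta>\<^sup>2) * P 1 ^ 3 - P 3"
  \<comment> \<open>The three cube roots of unity sum to zero, so one of them makes the last condition true.\<close>
  obtain u where u: "cmod u = 1" "u ^ 3 * c = cmod c" "0 \<le> Re (u * P 1)"
  proof -
    define w where "w = cis (- Arg c / 3)"
    define \<zeta> where "\<zeta> = cis (2 * pi / 3)"
    have w: "cmod w = 1" "w ^ 3 * c = cmod c"
    proof -
      have "w ^ 3 = cis (- Arg c)" by (simp add: w_def Complex.DeMoivre)
      moreover have "c = cmod c * cis (Arg c)" using rcis_cmod_Arg[of c] by (simp add: rcis_def)
      ultimately have "w ^ 3 * c = cmod c * (cis (- Arg c) * cis (Arg c))" by (metis mult.left_commute)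
      then show "w ^ 3 * c = cmod c" by (simp add: cis_mult)
    qed (simp add: w_def)
    have \<zeta>: "cmod \<zeta> = 1" "\<zeta> ^ 3 = 1" by (simp_all add: \<zeta>_def Complex.DeMoivre)
    have "\<zeta> \<noteq> 1"
      using sin_gt_zero[of "2 * pi / 3"] pi_gt_zero by (auto simp: \<zeta>_def complex_eq_iff)
    moreover have "(\<zeta> - 1) * (1 + \<zeta> + \<zeta>\<^sup>2) = 0"
      using \<zeta>(2) by (simp add: algebra_simps power2_eq_square power3_eq_cube)
    ultimately have "1 + \<zeta> + \<zeta>\<^sup>2 = 0" by simp
    then have "w * P 1 + w * \<zeta> * P 1 + w * \<zeta>\<^sup>2 * P 1 = 0"
      by (metis (no_types, opaque_lifting) distrib_left distrib_right mult.right_neutral mult_zero_left mult_zero_right)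
    then have "Re (w * P 1) + Re (w * \<zeta> * P 1) + Re (w * \<zeta>\<^sup>2 * P 1) = 0"
      by (metis plus_complex.sel(1) zero_complex.sel(1))
    then consider "0 \<le> Re (w * P 1)" | "0 \<le> Re (w * \<zeta> * P 1)" | "0 \<le> Re (w * \<zeta>\<^sup>2 * P 1)"
      by linarith
    then show ?thesis
    proof cases
      case 1 then show ?thesis using that w by blast
    next
      case 2 then show ?thesis using that[of "w * \<zeta>"] w \<zeta> by (simp add: norm_mult power_mult_distrib)
    next
      case 3
      have "(\<zeta>\<^sup>2) ^ 3 = 1" using \<zeta>(2) by (metis power_mult mult.commute power_one)
      then show ?thesis using 3 that[of "w * \<zeta>\<^sup>2"] w \<zeta>(1) by (simp add: norm_mult norm_power power_mult_distrib)
    qed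
  qed
  define q where "q z = p (u * z)" for z
  have in_ball: "u * z \<in> ball 0 1" if "z \<in> ball 0 1" for z
    using that u(1) by (simp add: norm_mult)
  have holq: "q holomorphic_on ball 0 1"
    unfolding q_def using in_ball
    by (intro holomorphic_on_compose_gen[OF _ hol, unfolded o_def] holomorphic_intros) auto
  have dq: "(deriv ^^ n) q 0 / fact n = u ^ n * P n" for n
    unfolding q_def P_def
    using higher_deriv_compose_linear[OF hol open_ball open_ball, where u=u and z=0 and n=n, of 0 1] in_ball
    by simp
  define a where "a = Re (u * P 1) / 2"
  define m where "m = Re (u ^ 3 * P 3) / 2"
  have trig: "0 \<le> k0 + k1 * a + k3 * m" if "\<And>t. 0 \<le> k0 + k1 * cos t + k3 * cos (3 * t)" for k0 k1 k3
    using caratheodory_trig_nonneg[OF holq _ _ that] p0 pos in_ball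
    unfolding dq by (simp add: a_def m_def q_def)
  have cos3: "cos (3 * t) = 4 * cos t ^ 3 - 3 * cos t" for t :: real
    using cos_treble_cos[of t] by simp
  have a1: "a \<le> 1"
    using trig[of 1 "-1" 0] by simp
  have mA: "0 \<le> 8 * A ^ 3 + (3 - 12 * A\<^sup>2) * a + m" if "1 / 2 \<le> A" for A
  proof -
    have "0 \<le> 8 * A ^ 3 + (3 - 12 * A\<^sup>2) * cos t + 1 * cos (3 * t)" for t
    proof -
      \<comment> \<open>The third root \<open>-2A\<close> is forced by the absence of a quadratic
        term, so that \<open>cos 2t\<close>, and with it \<open>p_2\<close>, does not occur. The
        condition \<open>A >= 1/2\<close> puts this root at or below -1.\<close>
      have "0 \<le> 4 * (cos t - A)\<^sup>2 * (cos t + 2 * A)"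
      proof (rule mult_nonneg_nonneg)
        show "0 \<le> cos t + 2 * A" using that cos_ge_minus_one[of t] by linarith
      qed simp
      also have "\<dots> = 8 * A ^ 3 + (3 - 12 * A\<^sup>2) * cos t + 1 * cos (3 * t)"
        unfolding cos3 by (simp add: power2_eq_square power3_eq_cube algebra_simps)
      finally show ?thesis .
    qed
    from trig[OF this] show ?thesis by simp
  qed
  have "cmod c = Re (u ^ 3 * c)" using u(2) by simp
  also have "\<dots> = \<beta>\<^sup>2 * Re ((u * P 1) ^ 3) - 2 * m"
  proof -
    have "u ^ 3 * c = complex_of_real (\<beta>\<^sup>2) * (u * P 1) ^ 3 - u ^ 3 * P 3"
      by (simp add: c_def power_mult_distrib algebra_simps)
    moreover have "Re (complex_of_real b * X - Y) = b * Re X - Re Y" for b X Y by simp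
    ultimately show ?thesis by (simp add: m_def del: times_complex.sel minus_complex.sel of_real_power)
  qed
  also have "\<dots> \<le> 8 * \<beta>\<^sup>2 * a ^ 3 - 2 * m"
  proof -
    \<comment> \<open>This is where the sign of \<open>Re (u p_1)\<close> is used: the imaginary
      part can then only lower the real part of the cube.\<close>
    have "Re (z ^ 3) \<le> Re z ^ 3" if "0 \<le> Re z" for z
    proof -
      have "Re (z ^ 3) = Re z ^ 3 - 3 * (Re z * (Im z)\<^sup>2)"
        by (simp add: power3_eq_cube power2_eq_square algebra_simps)
      then show ?thesis using that by simp
    qed
    from this[OF u(3)] have "Re ((u * P 1) ^ 3) \<le> 8 * a ^ 3"
      by (simp add: a_def power_divide)
    then have "\<beta>\<^sup>2 * Re ((u * P 1) ^ 3) \<le> \<beta>\<^sup>2 * (8 * a ^ 3)"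
      by (intro mult_left_mono) auto
    then show ?thesis by simp
  qed
  finally have "\<beta> / 3 * cmod c \<le> \<beta> / 3 * (8 * \<beta>\<^sup>2 * a ^ 3 - 2 * m)"
    using \<beta> by (intro mult_left_mono) auto
  also have "\<dots> \<le> J23_bound (1 - \<beta>)"
    using cubic_le_J23_bound[OF \<beta> _ a1 mA] u(3) by (simp add: a_def)
  finally show ?thesis by (simp add: c_def P_def)
qed

text \<open>Coefficient recursion from \<open>z G' = \<beta> G (p - 1)\<close>. The contributions of
  \<open>p_2\<close> to \<open>A_2 A_3\<close> and to \<open>A_4\<close> cancel, which is why a
  bound in \<open>p_1\<close> and \<open>p_3\<close> alone suffices. Indices of \<open>G\<close> are
  one lower than those of \<open>F\<close>.\<close>

lemma coeff_relation:
  assumes G: "G holomorphic_on ball 0 1" "G 0 = 1" and p: "p holomorphic_on ball 0 1" "p 0 = 1"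
    and eq: "\<And>z. z \<in> ball 0 1 \<Longrightarrow> z * deriv G z = G z * (\<beta> * (p z - 1))"
  shows "(deriv ^^ 1) G 0 / fact 1 * ((deriv ^^ 2) G 0 / fact 2) - (deriv ^^ 3) G 0 / fact 3
    = \<beta> / 3 * (\<beta>\<^sup>2 * ((deriv ^^ 1) p 0 / fact 1) ^ 3 - (deriv ^^ 3) p 0 / fact 3)"
proof -
  define A where "A = fps_expansion G 0"
  define B where "B = fps_expansion p 0"
  have A: "G has_fps_expansion A" and B: "p has_fps_expansion B"
    unfolding A_def B_def using G p by (auto intro!: has_fps_expansion_fps_expansion[of "ball 0 1"])
  have nth: "A $ n = (deriv ^^ n) G 0 / fact n" "B $ n = (deriv ^^ n) p 0 / fact n" for n
    by (simp_all add: A_def B_def fps_expansion_def)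
  have "(\<lambda>z. z * deriv G z) has_fps_expansion fps_X * fps_deriv A"
    by (intro fps_expansion_intros A)
  moreover have "(\<lambda>z. z * deriv G z) has_fps_expansion A * (fps_const \<beta> * (B - 1))"
  proof -
    have "\<forall>\<^sub>F z in nhds 0. z * deriv G z = G z * (\<beta> * (p z - 1))"
      using eventually_nhds_in_open[of "ball 0 1" "0::complex"] by (rule eventually_mono) (use eq in auto)
    moreover have "(\<lambda>z. G z * (\<beta> * (p z - 1))) has_fps_expansion A * (fps_const \<beta> * (B - 1))"
      by (intro fps_expansion_intros A B)
    ultimately show ?thesis by (rule iffD2[OF has_fps_expansion_cong[OF _ refl]])
  qed
  ultimately have eq: "fps_X * fps_deriv A = A * (fps_const \<beta> * (B - 1))"
    by (rule fps_expansion_unique_complex)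
  have A0: "A $ 0 = 1" "B $ 0 = 1" using G p by (simp_all add: nth)
  have n: "(fps_X * fps_deriv A) $ n = (A * (fps_const \<beta> * (B - 1))) $ n" for n
    by (simp only: eq)
  have e1: "A $ 1 = \<beta> * B $ 1"
    using n[of 1] A0 by (simp add: fps_mult_nth)
  have e2: "2 * A $ 2 = \<beta> * (B $ 2 + A $ 1 * B $ 1)"
    using n[of 2] A0 by (simp add: fps_mult_nth numeral_2_eq_2 algebra_simps)
  have e3: "3 * A $ 3 = \<beta> * (B $ 3 + A $ 1 * B $ 2 + A $ 2 * B $ 1)"
    using n[of 3] A0 by (simp add: fps_mult_nth numeral_3_eq_3 numeral_2_eq_2 algebra_simps)
  have six: "6 * (A $ 1 * A $ 2 - A $ 3) = 2 * (\<beta> * (\<beta>\<^sup>2 * (B $ 1) ^ 3 - B $ 3))"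
  proof -
    have "6 * (A $ 1 * A $ 2 - A $ 3) = 3 * A $ 1 * (2 * A $ 2) - 2 * (3 * A $ 3)"
      by (simp add: algebra_simps)
    also have "\<dots> = 3 * A $ 1 * (2 * A $ 2) - 2 * \<beta> * (B $ 3 + A $ 1 * B $ 2) - \<beta> * B $ 1 * (2 * A $ 2)"
      unfolding e3 by (simp add: algebra_simps)
    also have "\<dots> = 2 * (\<beta> * (\<beta>\<^sup>2 * (B $ 1) ^ 3 - B $ 3))"
      unfolding e2 e1 by (simp add: algebra_simps power2_eq_square power3_eq_cube)
    finally show ?thesis .
  qed
  have "A $ 1 * A $ 2 - A $ 3 = (6 * (A $ 1 * A $ 2 - A $ 3)) / 6" by simp
  also have "\<dots> = \<beta> / 3 * (\<beta>\<^sup>2 * (B $ 1) ^ 3 - B $ 3)" unfolding six by simp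
  finally show ?thesis unfolding nth .
qed

section \<open>Starlike maps of the form $g(x) x$\<close>

text \<open>The functional that evaluates an operator at \<open>u\<close> and then applies
  \<open>T\<close>. It puts \<open>T (D F (s u) u)\<close> into the same shape as
  \<open>T (F (s u))\<close>, with \<open>fderiv F\<close> in place of \<open>F\<close>, which
  allows iteration.\<close>

definition eval_functional ::
  "('b::real_normed_vector \<Rightarrow>\<^sub>L complex) \<Rightarrow> 'a::real_normed_vector \<Rightarrow> ('a \<Rightarrow>\<^sub>L 'b) \<Rightarrow>\<^sub>L complex" where
  "eval_functional T u = Blinfun (\<lambda>L. T (blinfun_apply L u))"

lemma eval_functional_apply [simp]: "eval_functional T u L = T (L u)"
  unfolding eval_functional_def
  by (subst bounded_linear_Blinfun_apply)
    (auto intro: bounded_linear_compose[OF blinfun.bounded_linear_right] blinfun.bounded_linear_left)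

lemma complex_linear_eval_functional:
  "complex_linear (blinfun_apply T) \<Longrightarrow> complex_linear (blinfun_apply (eval_functional T u))"
  by (simp add: complex_linear_def blinfun.bilinear_simps)

text \<open>Trades one scalar derivative for one Frechet derivative. Repeated application to
  \<open>F\<close>, \<open>fderiv F\<close> and so on identifies the coefficients of the iterated
  derivatives with Taylor coefficients in one variable.\<close>

lemma higher_deriv_along_line:
  fixes f :: "'a::complex_normed_vector \<Rightarrow> 'b::complex_normed_vector" and T :: "'b \<Rightarrow>\<^sub>L complex"
  assumes f: "f cholomorphic_on ball 0 1" and T: "complex_linear T"
  shows "(deriv ^^ Suc n) (\<lambda>s. T (f (s *\<^sub>C u))) 0
    = (deriv ^^ n) (\<lambda>s. eval_functional T u (fderiv f (s *\<^sub>C u))) 0"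
proof -
  have "\<forall>\<^sub>F s in nhds 0. s *\<^sub>C u \<in> ball 0 1"
  proof -
    have "isCont (\<lambda>s. norm (s *\<^sub>C u)) 0"
      unfolding norm_scaleC by (intro continuous_intros)
    then have "((\<lambda>s. norm (s *\<^sub>C u)) \<longlongrightarrow> norm (0 *\<^sub>C u)) (nhds 0)"
      using tendsto_at_iff_tendsto_nhds[of "\<lambda>s. norm (s *\<^sub>C u)" 0] unfolding isCont_def by blast
    then show ?thesis
      using order_tendstoD(2)[of "\<lambda>s. norm (s *\<^sub>C u)" 0 "nhds 0" 1] by simp
  qed
  then have "\<forall>\<^sub>F s in nhds 0. deriv (\<lambda>s. T (f (s *\<^sub>C u))) s = eval_functional T u (fderiv f (s *\<^sub>C u))"
  proof eventually_elim
    case (elim s)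
    then show ?case
      using has_field_derivative_along_line[OF f _ T, of 0 s u] by (simp add: DERIV_imp_deriv)
  qed
  then show ?thesis
    unfolding funpow_Suc_right o_def by (rule higher_deriv_cong_ev) simp
qed

lemma coeffs_along_line:
  fixes F :: "'a::complex_banach \<Rightarrow> 'a"
  assumes F: "F cholomorphic_on ball 0 1" and T: "complex_linear (blinfun_apply T)"
  shows "coeff2 F u T = (deriv ^^ 2) (\<lambda>s. T (F (s *\<^sub>C u))) 0 / fact 2"
    and "coeff3 F u T = (deriv ^^ 3) (\<lambda>s. T (F (s *\<^sub>C u))) 0 / fact 3"
    and "coeff4 F u T = (deriv ^^ 4) (\<lambda>s. T (F (s *\<^sub>C u))) 0 / fact 4"
proof -
  note D1 = cholomorphic_on_fderiv[OF F open_ball]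
  note D2 = cholomorphic_on_fderiv[OF D1 open_ball]
  note D3 = cholomorphic_on_fderiv[OF D2 open_ball]
  note T1 = complex_linear_eval_functional[OF T, of u]
  note T2 = complex_linear_eval_functional[OF T1, of u]
  note T3 = complex_linear_eval_functional[OF T2, of u]
  note d = higher_deriv_along_line[OF F T] higher_deriv_along_line[OF D1 T1] higher_deriv_along_line[OF D2 T2] higher_deriv_along_line[OF D3 T3]
  show "coeff2 F u T = (deriv ^^ 2) (\<lambda>s. T (F (s *\<^sub>C u))) 0 / fact 2"
    unfolding coeff2_def numeral_2_eq_2 d by simp
  show "coeff3 F u T = (deriv ^^ 3) (\<lambda>s. T (F (s *\<^sub>C u))) 0 / fact 3"
    unfolding coeff3_def numeral_3_eq_3 d by simp
  have four: "4 = Suc (Suc (Suc (Suc 0)))" by simp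
  show "coeff4 F u T = (deriv ^^ 4) (\<lambda>s. T (F (s *\<^sub>C u))) 0 / fact 4"
    unfolding coeff4_def four d by simp
qed

section \<open>Derivatives and Taylor coefficients of radial maps\<close>

lemma bounded_bilinear_scaleC:
  "bounded_bilinear (\<lambda>c (x::'a::complex_normed_vector). c *\<^sub>C x)"
proof
  show "(a + b) *\<^sub>C x = a *\<^sub>C x + b *\<^sub>C x" for a b and x :: 'a
    by (rule scaleC_add_left)
  show "a *\<^sub>C (x + y) = a *\<^sub>C x + a *\<^sub>C y" for a and x y :: 'a
    by (rule scaleC_add_right)
  show "(r *\<^sub>R a) *\<^sub>C x = r *\<^sub>R (a *\<^sub>C x)" "a *\<^sub>C (r *\<^sub>R x) = r *\<^sub>R (a *\<^sub>C x)" for r a and x :: 'a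
    by (simp_all add: scaleR_conv_of_real mult.commute scaleC_scaleC flip: scaleC_of_real)
  show "\<exists>K. \<forall>a (x::'a). norm (a *\<^sub>C x) \<le> norm a * norm x * K"
    by (rule exI[of _ 1]) (simp add: norm_scaleC)
qed

lemma support_functionals_nonempty:
  fixes x :: "'a::complex_normed_vector"
  assumes "x \<noteq> 0"
  obtains T where "T \<in> support_functionals x"
proof -
  obtain T :: "'a \<Rightarrow>\<^sub>L complex" where T: "complex_linear T" "\<And>y. cmod (T y) \<le> norm y" "T x = norm x"
    using complex_hahn_banach[of x] by blast
  have "norm T \<le> 1" using T(2) by (intro norm_blinfun_bound) simp_all
  moreover have "1 \<le> norm T" using norm_blinfun[of T x] T(3) assms by simp
  ultimately show ?thesis using that[of T] T by (simp add: support_functionals_def)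
qed

locale radial_map =
  fixes F :: "'a::complex_banach \<Rightarrow> 'a" and g :: "'a \<Rightarrow> complex"
  assumes g: "g cholomorphic_on ball 0 1" and g0: "g 0 = 1"
    and F: "\<And>x. x \<in> ball 0 1 \<Longrightarrow> F x = g x *\<^sub>C x"
begin

abbreviation "dg \<equiv> fderiv g"

lemma dg_scale: "x \<in> ball 0 1 \<Longrightarrow> dg x (c *\<^sub>C y) = c * dg x y"
  using complex_linear_scale[OF complex_linear_fderiv[OF g]] by (simp add: scaleC_complex_def)

lemma has_derivative_radial:
  assumes "x \<in> ball 0 1"
  shows "(F has_derivative (\<lambda>y. g x *\<^sub>C y + dg x y *\<^sub>C x)) (at x)"
  using bounded_bilinear.FDERIV[OF bounded_bilinear_scaleC has_derivative_fderiv[OF g assms] has_derivative_ident]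
  by (rule has_derivative_transform_within_open[OF _ open_ball assms]) (simp add: F)

lemma fderiv_radial: "x \<in> ball 0 1 \<Longrightarrow> fderiv F x y = g x *\<^sub>C y + dg x y *\<^sub>C x"
  using fderiv_eq[OF has_derivative_radial] by simp

lemma F_cholomorphic: "F cholomorphic_on ball 0 1"
  unfolding cholomorphic_on_def
proof
  fix x :: 'a assume x: "x \<in> ball 0 1"
  have "complex_linear (\<lambda>y. g x *\<^sub>C y + dg x y *\<^sub>C x)"
    using dg_scale[OF x]
    by (simp add: complex_linear_def scaleC_add_right scaleC_add_left blinfun.bilinear_simps 
        scaleC_scaleC mult.commute)
  then show "\<exists>f'. (F has_derivative f') (at x) \<and> complex_linear f'"
    using has_derivative_radial[OF x] by blast
qed

lemma G_derivative:
  assumes "norm u = 1" "z \<in> ball 0 1"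
  shows "((\<lambda>z. g (z *\<^sub>C u)) has_field_derivative dg (z *\<^sub>C u) u) (at z)"
  using has_field_derivative_along_line[OF g, of 0 z u id_blinfun] assms
  by (simp add: norm_scaleC complex_linear_def)

lemma G_holomorphic: "norm u = 1 \<Longrightarrow> (\<lambda>z. g (z *\<^sub>C u)) holomorphic_on ball 0 1"
  unfolding holomorphic_on_open[OF open_ball] using G_derivative by blast

text \<open>Since \<open>T u = 1\<close>, the slice of \<open>T F\<close> is \<open>s * G s\<close>,
  so each coefficient of \<open>F\<close> is the coefficient of \<open>G\<close> of index one
  lower.\<close>

lemma J23_radial:
  assumes u: "norm u = 1" and T: "T \<in> support_functionals u"
  defines "G \<equiv> \<lambda>z. g (z *\<^sub>C u)"
  shows "J23 F u T = (deriv ^^ 1) G 0 / fact 1 * ((deriv ^^ 2) G 0 / fact 2) - (deriv ^^ 3) G 0 / fact 3"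
proof -
  have T: "complex_linear T" "T u = 1"
    using T u by (simp_all add: support_functionals_def)
  have G: "G has_fps_expansion fps_expansion G 0"
    using has_fps_expansion_fps_expansion[OF open_ball _ G_holomorphic[OF u]] by (simp add: G_def)
  have "\<forall>\<^sub>F s in nhds (0::complex). s \<in> ball 0 1"
    by (rule eventually_nhds_in_open) auto
  then have "\<forall>\<^sub>F s in nhds 0. s * G s = T (F (s *\<^sub>C u))"
  proof eventually_elim
    case (elim s)
    then have "F (s *\<^sub>C u) = g (s *\<^sub>C u) *\<^sub>C s *\<^sub>C u" using u by (intro F) (simp add: norm_scaleC)
    then show ?case by (simp add: G_def complex_linear_scale[OF T(1)] T(2) scaleC_complex_def)
  qed
  moreover have "(\<lambda>s. s * G s) has_fps_expansion fps_X * fps_expansion G 0"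
    by (intro fps_expansion_intros G)
  ultimately have "(\<lambda>s. T (F (s *\<^sub>C u))) has_fps_expansion fps_X * fps_expansion G 0"
    by (rule iffD1[OF has_fps_expansion_cong[OF _ refl]])
  from fps_nth_fps_expansion[OF this]
  have "(deriv ^^ Suc n) (\<lambda>s. T (F (s *\<^sub>C u))) 0 / fact (Suc n) = (deriv ^^ n) G 0 / fact n" for n
    by (metis diff_Suc_1 fps_X_mult_nth fps_nth_fps_expansion[OF G] nat.simps(3))
  from this[of 1] this[of 2] this[of 3] show ?thesis
    unfolding J23_def coeffs_along_line[OF F_cholomorphic T(1)] by (simp add: eval_nat_numeral)
qed

end

text \<open>Inversion maps the disc to a half-plane: after multiplication by
  \<open>2 \<alpha> |q|\<close> the condition says that \<open>q\<close> is closer to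
  \<open>2 \<alpha>\<close> than to 0. In this form the case \<alpha> = 0 no longer stands
  apart.\<close>

lemma starlike_condition_iff:
  fixes q :: complex
  assumes "q \<noteq> 0" "0 < r" "0 \<le> \<alpha>"
  shows "(if \<alpha> = 0 then Re (of_real r / q) > 0
      else cmod (of_real r / q / complex_of_real r - complex_of_real (1 / (2 * \<alpha>))) < 1 / (2 * \<alpha>)) \<longleftrightarrow> \<alpha> < Re q"
proof (cases "\<alpha> = 0")
  case True
  have "Re (of_real r / q) = r * Re q / (cmod q)\<^sup>2"
    by (simp add: Re_divide cmod_power2)
  then show ?thesis using True assms by (simp add: zero_less_divide_iff zero_less_mult_iff)
next
  case False
  then have \<alpha>: "0 < \<alpha>" using assms by simp
  have "of_real r / q / complex_of_real r - complex_of_real (1 / (2 * \<alpha>)) = (2 * \<alpha> - q) / (2 * \<alpha> * q)"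
    using assms \<alpha> by (simp add: field_simps)
  then have "cmod (of_real r / q / complex_of_real r - complex_of_real (1 / (2 * \<alpha>))) < 1 / (2 * \<alpha>)
    \<longleftrightarrow> cmod (2 * \<alpha> - q) < cmod q"
    using assms \<alpha> by (simp add: norm_divide norm_mult field_simps)
  also have "\<dots> \<longleftrightarrow> (cmod (2 * \<alpha> - q))\<^sup>2 < (cmod q)\<^sup>2"
    by (metis norm_ge_zero not_le power_mono_iff zero_less_numeral)
  also have "\<dots> \<longleftrightarrow> \<alpha> * \<alpha> < \<alpha> * Re q"
    unfolding cmod_power2 by (simp add: power2_eq_square algebra_simps)
  also have "\<dots> \<longleftrightarrow> \<alpha> < Re q" using \<alpha> by simp
  finally show ?thesis using False by simp
qed

text \<open>\<open>DF(x)\<close> maps \<open>x\<close> to \<open>(g x + dg x x) x\<close>, so the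
  preimage of \<open>F x\<close> is found on the line through \<open>x\<close> without inverting the
  whole operator.\<close>

lemma (in radial_map) fderiv_radial_self:
  assumes "x \<in> ball 0 1" "g x + dg x x \<noteq> 0"
  shows "fderiv F x ((g x / (g x + dg x x)) *\<^sub>C x) = F x"
proof -
  define k where "k = g x / (g x + dg x x)"
  have "g x * k + k * dg x x = k * (g x + dg x x)" by (simp add: algebra_simps)
  also have "\<dots> = g x" using assms(2) by (simp add: k_def)
  finally show ?thesis
    unfolding k_def[symmetric] fderiv_radial[OF assms(1)] dg_scale[OF assms(1)] F[OF assms(1)]
    by (simp add: scaleC_scaleC flip: scaleC_add_left)
qed

lemma (in radial_map) starlike_imp:
  assumes S: "F \<in> starlike_maps \<alpha>" and "0 \<le> \<alpha>" and x: "x \<in> ball 0 1" "x \<noteq> 0"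
  shows "g x \<noteq> 0" and "\<alpha> < Re (1 + dg x x / g x)"
proof -
  define m where "m = g x + dg x x"
  obtain H where H: "fderiv F x o\<^sub>L H = id_blinfun" "H o\<^sub>L fderiv F x = id_blinfun"
    using S x(1) unfolding starlike_maps_def locally_biholomorphic_def by blast
  have inj: "inj (blinfun_apply (fderiv F x))"
    by (rule inj_on_inverseI[where g="blinfun_apply H"]) (metis H(2) blinfun_apply_blinfun_compose id_blinfun.rep_eq id_apply)
  have m0: "m \<noteq> 0"
  proof
    assume "m = 0"
    then have "fderiv F x x = fderiv F x 0"
      by (simp add: fderiv_radial[OF x(1)] m_def flip: scaleC_add_left)
    then show False using injD[OF inj] x(2) by blast
  qed
  have v: "inv (blinfun_apply (fderiv F x)) (F x) = (g x / m) *\<^sub>C x"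
    unfolding m_def by (rule inv_f_eq[OF inj fderiv_radial_self[OF x(1) m0[unfolded m_def]]])
  \<comment> \<open>The starlikeness condition quantifies over support functionals, so it yields
    something only because Hahn--Banach provides one.\<close>
  obtain T where T: "T \<in> support_functionals x"
    using support_functionals_nonempty[OF x(2)] .
  then have w: "T ((g x / m) *\<^sub>C x) = (g x / m) * norm x"
    by (simp add: support_functionals_def complex_linear_scale scaleC_complex_def)
  have cond: "if \<alpha> = 0 then Re ((g x / m) * norm x) > 0
     else cmod ((g x / m) * norm x / complex_of_real (norm x) - complex_of_real (1 / (2 * \<alpha>))) < 1 / (2 * \<alpha>)"
  proof -
    have "let w = T (inv (blinfun_apply (fderiv F x)) (F x)) in if \<alpha> = 0 then Re w > 0
        else cmod (w / complex_of_real (norm x) - complex_of_real (1 / (2 * \<alpha>))) < 1 / (2 * \<alpha>)"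
      using S T x unfolding starlike_maps_def by blast
    then show ?thesis unfolding Let_def v w .
  qed
  \<comment> \<open>If \<open>g x = 0\<close>, the tested value is 0, which lies on the boundary of
    the half-plane or disc and is excluded by the strict inequality.\<close>
  show g: "g x \<noteq> 0"
    using cond \<open>0 \<le> \<alpha>\<close> by (auto split: if_splits simp: norm_divide norm_mult)
  have eq: "(g x / m) * norm x = of_real (norm x) / (m / g x)" by simp
  have "m / g x \<noteq> 0" "0 < norm x" using m0 g x(2) by simp_all
  from cond[unfolded eq starlike_condition_iff[OF this \<open>0 \<le> \<alpha>\<close>]]
  show "\<alpha> < Re (1 + dg x x / g x)"
    using g by (simp add: m_def add_divide_distrib)
qed

lemma (in radial_map) starlikeI:
  assumes g_nz: "\<And>x. x \<in> ball 0 1 \<Longrightarrow> g x \<noteq> 0"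
    and re: "\<And>x. x \<in> ball 0 1 \<Longrightarrow> \<alpha> < Re (1 + dg x x / g x)" and "0 \<le> \<alpha>"
  shows "F \<in> starlike_maps \<alpha>"
proof -
  have m_nz: "g x + dg x x \<noteq> 0" if "x \<in> ball 0 1" for x
  proof -
    have "1 + dg x x / g x \<noteq> 0"
      using re[OF that] \<open>0 \<le> \<alpha>\<close> by (metis zero_complex.sel(1) not_le)
    then show ?thesis using g_nz[OF that] by (simp add: field_simps)
  qed
  have inverse: "\<exists>G. fderiv F x o\<^sub>L G = id_blinfun \<and> G o\<^sub>L fderiv F x = id_blinfun" if x: "x \<in> ball 0 1" for x
  proof -
    define m where "m = g x + dg x x"
    \<comment> \<open>\<open>fderiv F x\<close> is a rank-one perturbation of \<open>g x\<close>
      times the identity; this is its inverse by the Sherman--Morrison formula.\<close>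
    define h where "h y = (1 / g x) *\<^sub>C y + (- dg x y / (g x * m)) *\<^sub>C x" for y
    have "bounded_linear h"
      unfolding h_def
      by (intro bounded_linear_add bounded_linear_scaleC_right
          bounded_linear_compose[OF bounded_bilinear.bounded_linear_left[OF bounded_bilinear_scaleC]]
          bounded_linear_compose[OF bounded_linear_divide] bounded_linear_minus blinfun.bounded_linear_right)
    then have h: "blinfun_apply (Blinfun h) = h" by (rule bounded_linear_Blinfun_apply)
    have nz: "g x \<noteq> 0" "m \<noteq> 0" using g_nz m_nz x by (simp_all add: m_def)
    have "fderiv F x (h y) = y" for y
    proof -
      have "dg x (h y) = (1 / g x) * dg x y + (- dg x y / (g x * m)) * dg x x"
        unfolding h_def blinfun.add_right dg_scale[OF x] ..
      also have "\<dots> = dg x y / m"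
        using nz by (simp add: field_simps) (simp add: m_def algebra_simps)
      finally have "fderiv F x (h y) = g x *\<^sub>C h y + (dg x y / m) *\<^sub>C x"
        by (simp add: fderiv_radial[OF x])
      also have "\<dots> = y + (- dg x y / m + dg x y / m) *\<^sub>C x"
        using nz unfolding h_def scaleC_add_right scaleC_scaleC scaleC_add_left by (simp add: scaleC_one)
      finally show ?thesis by simp
    qed
    moreover have "h (fderiv F x y) = y" for y
    proof -
      have "dg x (fderiv F x y) = g x * dg x y + dg x y * dg x x"
        unfolding fderiv_radial[OF x] blinfun.add_right dg_scale[OF x] ..
      also have "\<dots> = dg x y * m" by (simp add: m_def algebra_simps)
      finally have "h (fderiv F x y) = (1 / g x) *\<^sub>C fderiv F x y + (- dg x y / g x) *\<^sub>C x"
        using nz by (simp add: h_def)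
      also have "\<dots> = y + (dg x y / g x + - dg x y / g x) *\<^sub>C x"
        using nz unfolding fderiv_radial[OF x] scaleC_add_right scaleC_scaleC scaleC_add_left by (simp add: scaleC_one)
      finally show ?thesis by simp
    qed
    ultimately show ?thesis
      by (intro exI[of _ "Blinfun h"] conjI blinfun_eqI) (simp_all add: h)
  qed
  have z: "(0::'a) \<in> ball 0 1" by simp
  have "normalized_map F"
    unfolding normalized_map_def using F[OF z] fderiv_radial[OF z] g0
    by (auto intro!: blinfun_eqI simp: scaleC_one)
  moreover have "locally_biholomorphic F"
    unfolding locally_biholomorphic_def using F_cholomorphic inverse by blast
  moreover have "let w = T (inv (blinfun_apply (fderiv F x)) (F x)) in
        if \<alpha> = 0 then Re w > 0
        else cmod (w / complex_of_real (norm x) - complex_of_real (1 / (2 * \<alpha>))) < 1 / (2 * \<alpha>)"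
    if x: "x \<in> ball 0 1 - {0}" and T: "T \<in> support_functionals x" for x T
  proof -
    define m where "m = g x + dg x x"
    have x': "x \<in> ball 0 1" "x \<noteq> 0" using x by auto
    have nz: "g x \<noteq> 0" "m \<noteq> 0" using g_nz m_nz x' by (simp_all add: m_def)
    obtain H where H: "H o\<^sub>L fderiv F x = id_blinfun" using inverse[OF x'(1)] by blast
    have inj: "inj (blinfun_apply (fderiv F x))"
      by (rule inj_on_inverseI[where g="blinfun_apply H"]) (metis H blinfun_apply_blinfun_compose id_blinfun.rep_eq id_apply)
    have v: "inv (blinfun_apply (fderiv F x)) (F x) = (g x / m) *\<^sub>C x"
      unfolding m_def by (rule inv_f_eq[OF inj fderiv_radial_self[OF x'(1) nz(2)[unfolded m_def]]])
    have w: "T ((g x / m) *\<^sub>C x) = of_real (norm x) / (m / g x)"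
      using T by (simp add: support_functionals_def complex_linear_scale scaleC_complex_def)
    have "\<alpha> < Re (m / g x)" using re[OF x'(1)] nz by (simp add: m_def add_divide_distrib)
    then show ?thesis
      using starlike_condition_iff[of "m / g x" "norm x" \<alpha>] nz x' \<open>0 \<le> \<alpha>\<close> unfolding v w Let_def by simp
  qed
  ultimately show ?thesis unfolding starlike_maps_def by blast
qed

theorem (in radial_map) J23_le:
  assumes S: "F \<in> starlike_maps \<alpha>" and \<alpha>: "0 \<le> \<alpha>" "\<alpha> < 1" and u: "norm u = 1" and T: "T \<in> support_functionals u"
  shows "cmod (J23 F u T) \<le> J23_bound \<alpha>"
proof -
  define \<beta> where "\<beta> = 1 - \<alpha>"
  have \<beta>: "0 < \<beta>" "\<beta> \<le> 1" using \<alpha> by (simp_all add: \<beta>_def)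
  define G where "G z = g (z *\<^sub>C u)" for z
  have hol: "G holomorphic_on ball 0 1" unfolding G_def by (rule G_holomorphic[OF u])
  have G0: "G 0 = 1" by (simp add: G_def g0)
  have zu: "z *\<^sub>C u \<in> ball 0 1" if "z \<in> ball 0 1" for z using that u by (simp add: norm_scaleC)
  have zu0: "z *\<^sub>C u \<noteq> 0" if "z \<noteq> 0" for z
    using that u by (metis norm_scaleC norm_eq_zero mult.right_neutral)
  have G_nz: "G z \<noteq> 0" if "z \<in> ball 0 1" for z
    using starlike_imp(1)[OF S \<alpha>(1) zu[OF that] zu0] G0 by (cases "z = 0") (auto simp: G_def)
  have dG: "deriv G z = dg (z *\<^sub>C u) u" if "z \<in> ball 0 1" for z
    unfolding G_def by (rule DERIV_imp_deriv[OF G_derivative[OF u that]])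
  \<comment> \<open>With \<open>q = 1 + z G'/G\<close> this is \<open>1 + (q - 1) / \<beta>\<close>,
    the affine map that fixes 1 and takes \<open>Re q > \<alpha>\<close> to the right
    half-plane.\<close>
  define p where "p z = 1 + z * deriv G z / G z / of_real \<beta>" for z
  have p0: "p 0 = 1" by (simp add: p_def)
  have p_hol: "p holomorphic_on ball 0 1"
    unfolding p_def using G_nz \<beta> by (intro holomorphic_intros hol holomorphic_deriv open_ball) auto
  have p_pos: "0 \<le> Re (p z)" if z: "z \<in> ball 0 1" for z
  proof (cases "z = 0")
    case False
    have "\<alpha> < Re (1 + z * deriv G z / G z)"
      using starlike_imp(2)[OF S \<alpha>(1) zu[OF z] zu0[OF False]] dG[OF z] dg_scale[OF zu[OF z]]
      by (simp add: G_def)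
    then have "- \<beta> < Re (z * deriv G z / G z)" by (simp add: \<beta>_def)
    then have "- 1 < Re (z * deriv G z / G z) / \<beta>"
      using \<beta> by (simp add: field_simps)
    then show ?thesis unfolding p_def plus_complex.sel one_complex.sel Re_divide_of_real by simp
  qed (simp add: p0)
  have eq: "z * deriv G z = G z * (of_real \<beta> * (p z - 1))" if "z \<in> ball 0 1" for z
    using G_nz[OF that] \<beta> by (simp add: p_def)
  have J: "J23 F u T = of_real (\<beta> / 3) * (\<beta>\<^sup>2 * ((deriv ^^ 1) p 0 / fact 1) ^ 3 - (deriv ^^ 3) p 0 / fact 3)"
    using J23_radial[OF u T, folded G_def[abs_def]] coeff_relation[OF hol G0 p_hol p0 eq] by simp
  have "cmod (J23 F u T) = \<beta> / 3 * cmod (\<beta>\<^sup>2 * ((deriv ^^ 1) p 0 / fact 1) ^ 3 - (deriv ^^ 3) p 0 / fact 3)"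
    unfolding J norm_mult norm_of_real using \<beta> by simp
  also have "\<dots> \<le> J23_bound (1 - \<beta>)"
    using caratheodory_coeff_bound[OF p_hol p0 _ \<beta>] p_pos by simp
  finally show ?thesis by (simp add: \<beta>_def)
qed

section \<open>Sharpness\<close>

text \<open>\<open>w / (1 - w)\<close> is \<open>((1 + w) / (1 - w) - 1) / 2\<close>, and
  \<open>(1 + w) / (1 - w)\<close> maps the disc to the right half-plane.\<close>

lemma Re_geometric_gt:
  assumes "cmod w < 1"
  shows "- 1 / 2 < Re (w / (1 - w))"
proof -
  have nz: "1 - w \<noteq> 0" using assms by auto
  have "0 < 1 - (cmod w)\<^sup>2"
    using assms by (simp add: power_less_one_iff abs_square_less_1)
  also have "\<dots> = 2 * (Re w * Re (1 - w) + Im w * Im (1 - w)) + (cmod (1 - w))\<^sup>2"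
    unfolding cmod_power2 by (simp add: power2_eq_square algebra_simps)
  finally have "- (cmod (1 - w))\<^sup>2 / 2 < Re w * Re (1 - w) + Im w * Im (1 - w)" by simp
  then have "- (cmod (1 - w))\<^sup>2 / 2 / (cmod (1 - w))\<^sup>2
      < (Re w * Re (1 - w) + Im w * Im (1 - w)) / (cmod (1 - w))\<^sup>2"
    using nz by (intro divide_strict_right_mono) auto
  moreover have "Re (w / (1 - w)) = (Re w * Re (1 - w) + Im w * Im (1 - w)) / (cmod (1 - w))\<^sup>2"
    unfolding Re_divide cmod_power2 ..
  ultimately show ?thesis using nz by simp
qed

text \<open>The extremal function is $(1 - 2 z \cos\theta + z^2)^{-\beta}$, written with logarithms of the
  two linear factors, which have positive real part on the disc.\<close>

lemma extremal_function:
  fixes \<theta> \<beta> :: real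
  obtains G p where "G holomorphic_on ball 0 1" "G 0 = 1" "\<forall>z\<in>ball 0 1. G z \<noteq> 0"
    "p holomorphic_on ball 0 1" "p 0 = 1" "\<forall>z\<in>ball 0 1. 0 < Re (p z)"
    "\<forall>z\<in>ball 0 1. z * deriv G z = G z * (of_real \<beta> * (p z - 1))"
    "(deriv ^^ 1) p 0 / fact 1 = of_real (2 * cos \<theta>)"
    "(deriv ^^ 3) p 0 / fact 3 = of_real (8 * cos \<theta> ^ 3 - 6 * cos \<theta>)"
proof -
  define e where "e = cis \<theta>"
  define d where "d = cis (- \<theta>)"
  have e: "cmod e = 1" and d: "cmod d = 1" and ed: "e * d = 1" "e + d = of_real (2 * cos \<theta>)"
    by (simp_all add: e_def d_def cis_mult complex_eq_iff)
  define G where "G z = exp (- of_real \<beta> * (Ln (1 - e * z) + Ln (1 - d * z)))" for z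
  \<comment> \<open>The average of the two half-plane maps \<open>(1 + e z) / (1 - e z)\<close> and
    \<open>(1 + d z) / (1 - d z)\<close>, that is, equal masses at the angles \<theta> and
    -\<theta>. Its coefficients are \<open>2 cos (n \<theta>)\<close>.\<close>
  define p where "p z = 1 + e * z / (1 - e * z) + d * z / (1 - d * z)" for z
  have small: "cmod (e * z) < 1" "cmod (d * z) < 1" if "z \<in> ball 0 1" for z
    using that e d by (simp_all add: norm_mult)
  have slit: "1 - w \<notin> \<real>\<^sub>\<le>\<^sub>0" "1 - w \<noteq> 0" if "cmod w < 1" for w
  proof -
    have "0 < Re (1 - w)" using that complex_Re_le_cmod[of w] by simp
    then show "1 - w \<notin> \<real>\<^sub>\<le>\<^sub>0" "1 - w \<noteq> 0" by (auto simp: complex_nonpos_Reals_iff)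
  qed
  have der: "(G has_field_derivative G z * (of_real \<beta> * (e / (1 - e * z) + d / (1 - d * z)))) (at z)"
    if "z \<in> ball 0 1" for z
    unfolding G_def using slit[OF small(1)[OF that]] slit[OF small(2)[OF that]]
    by (auto intro!: derivative_eq_intros simp: field_simps)
  have p_hol: "p holomorphic_on ball 0 1"
    unfolding p_def using slit(2) small by (intro holomorphic_intros) auto
  show ?thesis
  proof (rule that[of G p])
    show "G holomorphic_on ball 0 1"
      unfolding holomorphic_on_open[OF open_ball] using der by blast
    show "\<forall>z\<in>ball 0 1. 0 < Re (p z)"
    proof
      fix z :: complex assume z: "z \<in> ball 0 1"
      show "0 < Re (p z)"
        using Re_geometric_gt[OF small(1)[OF z]] Re_geometric_gt[OF small(2)[OF z]]
        unfolding p_def plus_complex.sel by simp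
    qed
    show "\<forall>z\<in>ball 0 1. z * deriv G z = G z * (of_real \<beta> * (p z - 1))"
    proof
      fix z :: complex assume z: "z \<in> ball 0 1"
      show "z * deriv G z = G z * (of_real \<beta> * (p z - 1))"
        unfolding DERIV_imp_deriv[OF der[OF z]] p_def by (simp add: algebra_simps)
    qed
    define B where "B = fps_expansion p 0"
    have B: "p has_fps_expansion B"
      unfolding B_def using has_fps_expansion_fps_expansion[OF open_ball _ p_hol] by simp
    define c where "c = complex_of_real (2 * cos \<theta>)"
    have "\<forall>\<^sub>F z in nhds (0::complex). z \<in> ball 0 1"
      by (rule eventually_nhds_in_open) auto
    then have "\<forall>\<^sub>F z in nhds 0. (1 - c * z + z ^ 2) * p z = 1 - z ^ 2"
    proof eventually_elim
      case (elim z)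
      have nz: "1 - e * z \<noteq> 0" "1 - d * z \<noteq> 0" using slit(2) small[OF elim] by blast+
      have c: "1 - c * z + z ^ 2 = (1 - e * z) * (1 - d * z)"
      proof -
        have "(1 - e * z) * (1 - d * z) = 1 - (e + d) * z + (e * d) * z ^ 2"
          by (simp add: algebra_simps power2_eq_square)
        then show ?thesis unfolding ed c_def by simp
      qed
      have "(1 - e * z) * (1 - d * z) * p z = 
          (1 - e * z) * (1 - d * z) + e * z * (1 - d * z) + d * z * (1 - e * z)"
        using nz by (simp add: p_def distrib_left)
      also have "\<dots> = 1 - (e * d) * z ^ 2"
        by (simp add: algebra_simps power2_eq_square)
      finally show ?case unfolding c ed by simp
    qed
    moreover have "(\<lambda>z. 1 - z ^ 2) has_fps_expansion 1 - fps_X ^ 2"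
      by (intro fps_expansion_intros)
    ultimately have "(\<lambda>z. (1 - c * z + z ^ 2) * p z) has_fps_expansion 1 - fps_X ^ 2"
      by (rule iffD2[OF has_fps_expansion_cong[OF _ refl]])
    moreover have "(\<lambda>z. (1 - c * z + z ^ 2) * p z) has_fps_expansion (1 - fps_const c * fps_X + fps_X ^ 2) * B"
      by (intro fps_expansion_intros B)
    ultimately have eq: "(1 - fps_const c * fps_X + fps_X ^ 2) * B = 1 - fps_X ^ 2"
      using fps_expansion_unique_complex by blast
    then have "B = 1 - fps_X ^ 2 + fps_const c * (fps_X * B) - fps_X ^ 2 * B"
      by (simp add: algebra_simps)
    \<comment> \<open>For \<open>n >= 3\<close> this is the recurrence
      \<open>B_n = c B_(n-1) - B_(n-2)\<close> of \<open>2 cos (n \<theta>)\<close>; the term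
      \<open>1 - X^2\<close> only adjusts the start.\<close>
    then have nth: "B $ n = (1 - fps_X ^ 2 + fps_const c * (fps_X * B) - fps_X ^ 2 * B) $ n" for n
      by (rule arg_cong)
    have B0: "B $ 0 = 1" using nth[of 0] by (simp add: fps_X_power_mult_nth)
    have B1: "B $ 1 = c" using nth[of 1] B0 by (simp add: fps_X_power_mult_nth)
    have B2: "B $ 2 = c * c - 2" using nth[of 2] B0 B1 by (simp add: fps_X_power_mult_nth)
    have B3: "B $ 3 = c * (c * c - 2) - c"
      using nth[of 3] B1 B2 by (simp add: fps_X_power_mult_nth)
    show "(deriv ^^ 1) p 0 / fact 1 = of_real (2 * cos \<theta>)"
      using B1 fps_nth_fps_expansion[OF B, of 1] by (simp add: c_def)
    have "(deriv ^^ 3) p 0 / fact 3 = c ^ 3 - 3 * c"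
      using B3 fps_nth_fps_expansion[OF B, of 3] by (simp add: power3_eq_cube algebra_simps)
    also have "\<dots> = of_real (8 * cos \<theta> ^ 3 - 6 * cos \<theta>)"
      by (simp add: c_def power3_eq_cube)
    finally show "(deriv ^^ 3) p 0 / fact 3 = of_real (8 * cos \<theta> ^ 3 - 6 * cos \<theta>)" .
  qed (use p_hol in \<open>simp_all add: G_def p_def\<close>)
qed

text \<open>\<open>cos \<theta>\<close> is the maximiser of the cubic from the upper bound: 1 in the
  first case, \<open>1/(2s)\<close> in the second, where \<open>s > 1/2\<close> makes it a
  legitimate cosine.\<close>

lemma extremal_parameter:
  fixes \<beta> :: real
  assumes \<beta>: "0 < \<beta>" "\<beta> \<le> 1"
  obtains \<theta> where "\<beta> / 3 * (\<beta>\<^sup>2 * (2 * cos \<theta>) ^ 3 - (8 * cos \<theta> ^ 3 - 6 * cos \<theta>)) = J23_bound (1 - \<beta>)"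
proof (cases "sqrt 3 / 2 \<le> \<beta>")
  case True
  show ?thesis
    by (rule that[of 0]) (use True in \<open>simp add: J23_bound_def algebra_simps\<close>)
next
  case False
  define s where "s = sqrt (1 - \<beta>\<^sup>2)"
  have "\<beta>\<^sup>2 < (sqrt 3 / 2)\<^sup>2"
    using False \<beta> by (intro power_strict_mono) auto
  then have lt: "1 / 4 < 1 - \<beta>\<^sup>2" by (simp add: power_divide)
  have s2: "\<beta>\<^sup>2 = 1 - s\<^sup>2" using lt by (simp add: s_def)
  have "sqrt (1 / 4) < s" unfolding s_def using lt by (rule real_sqrt_less_mono)
  then have s: "1 / 2 < s" by (simp add: real_sqrt_divide)
  define \<theta> where "\<theta> = arccos (1 / (2 * s))"
  have c: "cos \<theta> = 1 / (2 * s)"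
    unfolding \<theta>_def using s by (intro cos_arccos) (auto simp: field_simps)
  have "\<beta>\<^sup>2 * (2 * cos \<theta>) ^ 3 - (8 * cos \<theta> ^ 3 - 6 * cos \<theta>) = 2 / s"
    unfolding c s2 using s by (simp add: power_divide power3_eq_cube power2_eq_square field_simps)
  then have "\<beta> / 3 * (\<beta>\<^sup>2 * (2 * cos \<theta>) ^ 3 - (8 * cos \<theta> ^ 3 - 6 * cos \<theta>)) = J23_bound (1 - \<beta>)"
    using False by (simp add: J23_bound_def s_def)
  then show ?thesis using that by blast
qed

text \<open>Needed for sharpness: the extremal value is computed as a real number, and its modulus
  equals the bound only if the bound is nonnegative.\<close>

lemma J23_bound_nonneg: "0 < \<beta> \<Longrightarrow> \<beta> \<le> 1 \<Longrightarrow> 0 \<le> J23_bound (1 - \<beta>)"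
proof -
  assume \<beta>: "0 < \<beta>" "\<beta> \<le> 1"
  have "0 \<le> 4 * \<beta>\<^sup>2 - 1" if "sqrt 3 / 2 \<le> \<beta>"
  proof -
    have "(sqrt 3 / 2)\<^sup>2 \<le> \<beta>\<^sup>2" using that by (intro power_mono) auto
    then show ?thesis by (simp add: power_divide)
  qed
  then show ?thesis using \<beta> power_le_one[of \<beta> 2] by (simp add: J23_bound_def)
qed

text \<open>The one-variable extremal function is transplanted by \<open>g = G o T\<close> with a
  support functional \<open>T\<close> of \<open>u\<close>. Since \<open>|T y| <= norm y\<close>, the
  argument stays in the disc, and \<open>dg y y = T y * G' (T y)\<close> makes starlikeness at
  \<open>y\<close> a statement about \<open>p\<close> at \<open>T y\<close>. On the line through
  \<open>u\<close>, \<open>g\<close> is \<open>G\<close> itself.\<close>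

theorem J23_sharp:
  fixes \<alpha> :: real
  assumes "(x :: 'a::complex_banach) \<noteq> 0" and \<alpha>: "0 \<le> \<alpha>" "\<alpha> < 1"
  shows "\<exists>(F :: 'a \<Rightarrow> 'a) (g :: 'a \<Rightarrow> complex).
            g cholomorphic_on ball 0 1 \<and> g 0 = 1 \<and>
            (\<forall>x\<in>ball 0 1. F x = g x *\<^sub>C x) \<and> F \<in> starlike_maps \<alpha> \<and>
            (\<exists>u. norm u = 1 \<and> (\<exists>T\<in>support_functionals u. cmod (J23 F u T) = J23_bound \<alpha>))"
proof -
  define \<beta> where "\<beta> = 1 - \<alpha>"
  have \<beta>: "0 < \<beta>" "\<beta> \<le> 1" using \<alpha> by (simp_all add: \<beta>_def)
  define u where "u = (1 / norm x) *\<^sub>R x"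
  have u: "norm u = 1" using assms(1) by (simp add: u_def)
  then have "u \<noteq> 0" by auto
  then obtain T where T: "T \<in> support_functionals u"
    by (rule support_functionals_nonempty)
  then have T_lin: "complex_linear T" and Tu: "T u = 1" and "norm T = 1"
    using u unfolding support_functionals_def by auto
  then have T_le: "cmod (T y) \<le> norm y" for y using norm_blinfun[of T y] by simp
  obtain \<theta> where \<theta>: "\<beta> / 3 * (\<beta>\<^sup>2 * (2 * cos \<theta>) ^ 3 - (8 * cos \<theta> ^ 3 - 6 * cos \<theta>)) = J23_bound (1 - \<beta>)"
    using extremal_parameter[OF \<beta>] .
  obtain G p where G: "G holomorphic_on ball 0 1" "G 0 = 1" "\<forall>z\<in>ball 0 1. G z \<noteq> 0"
    and p: "p holomorphic_on ball 0 1" "p 0 = 1" "\<forall>z\<in>ball 0 1. 0 < Re (p z)"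
    and eq: "\<forall>z\<in>ball 0 1. z * deriv G z = G z * (of_real \<beta> * (p z - 1))"
    and P: "(deriv ^^ 1) p 0 / fact 1 = of_real (2 * cos \<theta>)"
      "(deriv ^^ 3) p 0 / fact 3 = of_real (8 * cos \<theta> ^ 3 - 6 * cos \<theta>)"
    by (rule extremal_function)
  define g where "g y = G (T y)" for y
  define F where "F y = g y *\<^sub>C y" for y
  have Ty: "T y \<in> ball 0 1" if "y \<in> ball 0 1" for y using that T_le[of y] by simp
  have g_der: "(g has_derivative (\<lambda>v. T v * deriv G (T y))) (at y)" if "y \<in> ball 0 1" for y
  proof -
    have "(G has_derivative (\<lambda>z. z * deriv G (T y))) (at (T y))"
      using holomorphic_derivI[OF G(1) open_ball Ty[OF that]] 
      by (simp add: has_field_derivative_def mult_commute_abs)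
    from has_derivative_compose[OF bounded_linear_imp_has_derivative[OF blinfun.bounded_linear_right] this]
    show ?thesis unfolding g_def .
  qed
  interpret radial_map F g
  proof
    show "g cholomorphic_on ball 0 1"
      unfolding cholomorphic_on_def
    proof
      fix y :: 'a assume "y \<in> ball 0 1"
      moreover have "complex_linear (\<lambda>v. T v * deriv G (T y))"
        by (simp add: complex_linear_def blinfun.add_right complex_linear_scale[OF T_lin]
            scaleC_complex_def algebra_simps)
      ultimately show "\<exists>f'. (g has_derivative f') (at y) \<and> complex_linear f'"
        using g_der by blast
    qed
  qed (simp_all add: g_def F_def G(2))
  have dg: "dg y y / g y = of_real \<beta> * (p (T y) - 1)" if "y \<in> ball 0 1" for y
    using eq[rule_format, OF Ty[OF that]] G(3)[rule_format, OF Ty[OF that]] fderiv_eq[OF g_der[OF that]]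
    by (simp add: g_def)
  have S: "F \<in> starlike_maps \<alpha>"
  proof (rule starlikeI)
    show "g y \<noteq> 0" if "y \<in> ball 0 1" for y unfolding g_def by (rule G(3)[rule_format, OF Ty[OF that]])
    show "\<alpha> < Re (1 + dg y y / g y)" if "y \<in> ball 0 1" for y
    proof -
      have "0 < \<beta> * Re (p (T y))" using p(3)[rule_format, OF Ty[OF that]] \<beta> by simp
      then show ?thesis unfolding dg[OF that] by (simp add: \<beta>_def algebra_simps)
    qed
  qed fact
  have G_u: "(\<lambda>z. g (z *\<^sub>C u)) = G"
    by (simp add: g_def complex_linear_scale[OF T_lin] Tu scaleC_complex_def)
  have "J23 F u T = of_real \<beta> / 3 *
      ((of_real \<beta>)\<^sup>2 * ((deriv ^^ 1) p 0 / fact 1) ^ 3 - (deriv ^^ 3) p 0 / fact 3)"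
    unfolding J23_radial[OF u T] G_u
    by (rule coeff_relation[OF G(1,2) p(1,2)]) (use eq in blast)
  also have "\<dots> = of_real (\<beta> / 3 * (\<beta>\<^sup>2 * (2 * cos \<theta>) ^ 3 - (8 * cos \<theta> ^ 3 - 6 * cos \<theta>)))"
    unfolding P by simp
  finally have "cmod (J23 F u T) = J23_bound \<alpha>"
    unfolding \<theta> using J23_bound_nonneg[OF \<beta>] by (simp add: \<beta>_def)
  then show ?thesis using g g0 F S u T by blast
qed

theorem theorem4p1:
  fixes \<alpha> :: real
  assumes "\<exists>x::'a::complex_banach. x \<noteq> 0"
    and "0 \<le> \<alpha>" and "\<alpha> < 1"
  shows "(\<forall>(F :: 'a \<Rightarrow> 'a) (g :: 'a \<Rightarrow> complex).
            g cholomorphic_on ball 0 1 \<and> g 0 = 1 \<and>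
            (\<forall>x\<in>ball 0 1. F x = g x *\<^sub>C x) \<and> F \<in> starlike_maps \<alpha> \<longrightarrow>
            (\<forall>x0. norm x0 = 1 \<longrightarrow>
              (\<forall>T\<in>support_functionals x0. cmod (J23 F x0 T) \<le> J23_bound \<alpha>))) \<and>
         (\<exists>(F :: 'a \<Rightarrow> 'a) (g :: 'a \<Rightarrow> complex).
            g cholomorphic_on ball 0 1 \<and> g 0 = 1 \<and>
            (\<forall>x\<in>ball 0 1. F x = g x *\<^sub>C x) \<and> F \<in> starlike_maps \<alpha> \<and>
            (\<exists>x0. norm x0 = 1 \<and>
              (\<exists>T\<in>support_functionals x0. cmod (J23 F x0 T) = J23_bound \<alpha>)))"
proof (intro conjI allI impI ballI; (elim conjE)?)
  fix F :: "'a \<Rightarrow> 'a" and g :: "'a \<Rightarrow> complex" and x0 :: 'a and T :: "'a \<Rightarrow>\<^sub>L complex"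
  assume "g cholomorphic_on ball 0 1" "g 0 = 1" "\<forall>x\<in>ball 0 1. F x = g x *\<^sub>C x"
    and *: "F \<in> starlike_maps \<alpha>" "norm x0 = 1" "T \<in> support_functionals x0"
  then interpret radial_map F g by unfold_locales auto
  show "cmod (J23 F x0 T) \<le> J23_bound \<alpha>"
    using J23_le * assms(2,3) by blast
qed (use assms J23_sharp in blast)

end
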